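(* Let $(X,d,\mu)$ be a bounded (and possibly non-Euclidean) metric measure space, and let $K_B$ be its associated doubly centered kernel. For a map $f\colon X\to\ell^2$ (respectively $f\colon X\to\mathbb{R}^m$, for a positive integer $m$) let $$\mathrm{Strain}(f)=\int_X\int_X\bigl(K_B(x,t)-\langle f(x),f(t)\rangle\bigr)^2\,\mu(dt)\,\mu(dx).$$ Then $\mathrm{Strain}$ is minimized over all maps $f\colon X\to\ell^2$ by the MDS embedding $f\colon X\to \ell^2$, and, for every $m$, $\mathrm{Strain}$ is minimized over all maps $f\colon X\to\mathbb{R}^m$ by the MDS embedding $f_m\colon X\to\mathbb{R}^m$.
   Context: A metric measure space $(X,d,\mu)$ is a compact metric space $(X,d)$ with a Borel probability measure $\mu$ on $X$ (full support is not assumed). It is bounded if $d$ is bounded; $d$ is regarded as an element of $L^2(X\times X,\mu\otimes\mu)$. It is Euclidean if $(X,d)$ embeds isometrically into $\ell^2$. Set $K_A(x,s)=-\tfrac12 d^2(x,s)$ and $$K_B(x,s)=K_A(x,s)-\int_X K_A(w,s)\,\mu(dw)-\int_X K_A(x,z)\,\mu(dz)+\int_{X\times X}K_A(w,z)\,\mu(dw)\,\mu(dz),$$ with $K_B\in L^2(X\times X,\mu\otimes\mu)$. Let $T_{K_B}\colon L^2(X,\mu)\to L^2(X,\mu)$, $[T_{K_B}\phi](x)=\int_X K_B(x,s)\phi(s)\,\mu(ds)$; this is a self-adjoint Hilbert–Schmidt operator. Let $\lambda_1\ge\lambda_2\ge\cdots$ be its eigenvalues (with multiplicity) with real-valued orthonormal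 eigenfunctions $\phi_1,\phi_2,\ldots$, and set $\hat\lambda_i=\max(\lambda_i,0)$. (Since $\hat\lambda_i=0$ for nonpositive eigenvalues, only the positive eigenvalues, listed in non-increasing order, matter; missing coordinates are $0$.) The MDS embedding of $X$ into $\ell^2$ is $f(x)=\bigl(\sqrt{\hat\lambda_1}\,\phi_1(x),\sqrt{\hat\lambda_2}\,\phi_2(x),\ldots\bigr)$ and the MDS embedding into $\mathbb{R}^m$ is $f_m(x)=\bigl(\sqrt{\hat\lambda_1}\,\phi_1(x),\ldots,\sqrt{\hat\lambda_m}\,\phi_m(x)\bigr)$. The competing maps $f$ are measurable maps whose inner product kernel $(x,t)\mapsto\langle f(x),f(t)\rangle$ lies in $L^2(X\times X,\mu\otimes\mu)$; the strain then equals $\|T_{K_B}-T_{K_{\hat B}}\|_{HS}^2=\mathrm{Tr}\bigl((T_{K_B}-T_{K_{\hat B}})^2\bigr)$, where $T_{K_{\hat B}}$ is the integral operator with kernel $K_{\hat B}(x,t)=\langle f(x),f(t)\rangle$.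
   Formalization: The MDS coordinates need not be square-summable for non-Euclidean X, so the claim for maps into ℓ² is proved whenever the MDS embedding is ℓ²-valued; for all X, the L² limit of its inner product kernels has strain at most that of every map into ℓ². *)

theory Defs
  imports "HOL-Probability.Probability"
begin

section \<open>The real Hilbert space of square-summable sequences\<close>

typedef ell2 = "{u :: nat \<Rightarrow> real. summable (\<lambda>i. (u i)\<^sup>2)}"
  morphisms coord Abs_ell2
  by (rule exI[of _ "\<lambda>_. 0"]) simp

lemma summable_coord_square: "summable (\<lambda>i. (coord u i)\<^sup>2)"
  using coord[of u] by simp

lemma ell2_eqI: "(\<And>i. coord u i = coord v i) \<Longrightarrow> u = v"
  by (simp add: coord_inject[symmetric] fun_eq_iff)

lemma summable_mult_if_summable_squares:
  fixes u v :: "nat \<Rightarrow> real"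
  assumes "summable (\<lambda>i. (u i)\<^sup>2)" and "summable (\<lambda>i. (v i)\<^sup>2)"
  shows "summable (\<lambda>i. u i * v i)"
proof (rule summable_comparison_test')
  show "summable (\<lambda>i. (u i)\<^sup>2 + (v i)\<^sup>2)"
    using assms by (rule summable_add)
  fix i :: nat
  have "0 \<le> (\<bar>u i\<bar> - \<bar>v i\<bar>)\<^sup>2" by simp
  then have "2 * (\<bar>u i\<bar> * \<bar>v i\<bar>) \<le> (u i)\<^sup>2 + (v i)\<^sup>2"
    by (simp add: power2_eq_square algebra_simps)
  moreover have "0 \<le> \<bar>u i\<bar> * \<bar>v i\<bar>" by simp
  ultimately show "norm (u i * v i) \<le> (u i)\<^sup>2 + (v i)\<^sup>2"
    unfolding real_norm_def abs_mult by linarith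
qed

lemma summable_coord_mult: "summable (\<lambda>i. coord u i * coord v i)"
  by (intro summable_mult_if_summable_squares summable_coord_square)

lemma summable_square_add:
  fixes u v :: "nat \<Rightarrow> real"
  assumes "summable (\<lambda>i. (u i)\<^sup>2)" and "summable (\<lambda>i. (v i)\<^sup>2)"
  shows "summable (\<lambda>i. (u i + v i)\<^sup>2)"
proof -
  have "summable (\<lambda>i. (u i)\<^sup>2 + (v i)\<^sup>2 + 2 * (u i * v i))"
    by (intro summable_add summable_mult summable_mult_if_summable_squares assms)
  then show ?thesis
    by (simp add: power2_sum mult.assoc)
qed

instantiation ell2 :: real_vector
begin

definition zero_ell2 :: ell2 where
  "0 = Abs_ell2 (\<lambda>_. 0)"

definition plus_ell2 :: "ell2 \<Rightarrow> ell2 \<Rightarrow> ell2" where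
  "u + v = Abs_ell2 (\<lambda>i. coord u i + coord v i)"

definition scaleR_ell2 :: "real \<Rightarrow> ell2 \<Rightarrow> ell2" where
  "r *\<^sub>R u = Abs_ell2 (\<lambda>i. r * coord u i)"

definition uminus_ell2 :: "ell2 \<Rightarrow> ell2" where
  "- u = Abs_ell2 (\<lambda>i. - coord u i)"

definition minus_ell2 :: "ell2 \<Rightarrow> ell2 \<Rightarrow> ell2" where
  "u - v = Abs_ell2 (\<lambda>i. coord u i - coord v i)"

lemma coord_zero: "coord 0 i = 0"
  by (simp add: zero_ell2_def Abs_ell2_inverse)

lemma coord_plus: "coord (u + v) i = coord u i + coord v i"
  by (simp add: plus_ell2_def Abs_ell2_inverse summable_square_add summable_coord_square)

lemma coord_scaleR: "coord (r *\<^sub>R u) i = r * coord u i"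
  by (simp add: scaleR_ell2_def Abs_ell2_inverse power_mult_distrib summable_mult
      summable_coord_square)

lemma coord_uminus: "coord (- u) i = - coord u i"
  by (simp add: uminus_ell2_def Abs_ell2_inverse summable_coord_square)

lemma coord_minus: "coord (u - v) i = coord u i - coord v i"
  using summable_square_add[OF summable_coord_square[of u] summable_coord_square[of "- v"]]
  by (simp add: minus_ell2_def Abs_ell2_inverse coord_uminus)

lemmas coord_simps = coord_zero coord_plus coord_scaleR coord_uminus coord_minus

instance
proof
  fix u v w :: ell2 and r s :: real
  show "u + v + w = u + (v + w)" by (rule ell2_eqI) (simp add: coord_simps)
  show "u + v = v + u" by (rule ell2_eqI) (simp add: coord_simps)
  show "0 + u = u" by (rule ell2_eqI) (simp add: coord_simps)
  show "- u + u = 0" by (rule ell2_eqI) (simp add: coord_simps)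
  show "u - v = u + - v" by (rule ell2_eqI) (simp add: coord_simps)
  show "r *\<^sub>R (u + v) = r *\<^sub>R u + r *\<^sub>R v"
    by (rule ell2_eqI) (simp add: coord_simps algebra_simps)
  show "(r + s) *\<^sub>R u = r *\<^sub>R u + s *\<^sub>R u"
    by (rule ell2_eqI) (simp add: coord_simps algebra_simps)
  show "r *\<^sub>R s *\<^sub>R u = (r * s) *\<^sub>R u"
    by (rule ell2_eqI) (simp add: coord_simps)
  show "1 *\<^sub>R u = u" by (rule ell2_eqI) (simp add: coord_simps)
qed

end

instantiation ell2 :: real_normed_vector
begin

definition norm_ell2 :: "ell2 \<Rightarrow> real" where
  "norm (u :: ell2) = sqrt (\<Sum>i. (coord u i)\<^sup>2)"

definition sgn_ell2 :: "ell2 \<Rightarrow> ell2" where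
  "sgn (u :: ell2) = u /\<^sub>R norm u"

definition dist_ell2 :: "ell2 \<Rightarrow> ell2 \<Rightarrow> real" where
  "dist (u :: ell2) v = norm (u - v)"

definition uniformity_ell2 :: "(ell2 \<times> ell2) filter" where
  "uniformity = (INF e\<in>{0<..}. principal {(u :: ell2, v). dist u v < e})"

definition open_ell2 :: "ell2 set \<Rightarrow> bool" where
  "open (U :: ell2 set) \<longleftrightarrow> (\<forall>u\<in>U. eventually (\<lambda>(u', v). u' = u \<longrightarrow> v \<in> U) uniformity)"

instance
proof
  fix u v :: ell2 and r :: real and U :: "ell2 set"
  show "dist u v = norm (u - v)" by (rule dist_ell2_def)
  show "sgn u = u /\<^sub>R norm u" by (rule sgn_ell2_def)
  show "(uniformity :: (ell2 \<times> ell2) filter) = (INF e\<in>{0<..}. principal {(u, v). dist u v < e})"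
    by (rule uniformity_ell2_def)
  show "open U \<longleftrightarrow> (\<forall>u\<in>U. eventually (\<lambda>(u', v). u' = u \<longrightarrow> v \<in> U) uniformity)"
    by (rule open_ell2_def)
  show "norm u = 0 \<longleftrightarrow> u = 0"
  proof
    assume "norm u = 0"
    then have "(coord u i)\<^sup>2 = 0" for i
      using suminf_eq_zero_iff[OF summable_coord_square[of u]] by (simp add: norm_ell2_def)
    then show "u = 0" by (intro ell2_eqI) (simp add: coord_simps)
  qed (simp add: norm_ell2_def coord_simps)
  show "norm (r *\<^sub>R u) = \<bar>r\<bar> * norm u"
    by (simp add: norm_ell2_def coord_simps power_mult_distrib suminf_mult
        summable_coord_square real_sqrt_mult)
  have lim: "(\<lambda>n. L2_set (coord w) {..<n}) \<longlonglongrightarrow> norm w" for w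
    unfolding L2_set_def norm_ell2_def
    by (intro tendsto_real_sqrt summable_LIMSEQ summable_coord_square)
  show "norm (u + v) \<le> norm u + norm v"
  proof (rule LIMSEQ_le[OF lim tendsto_add[OF lim lim]], intro exI allI impI)
    fix n :: nat
    show "L2_set (coord (u + v)) {..<n} \<le> L2_set (coord u) {..<n} + L2_set (coord v) {..<n}"
      unfolding coord_plus[abs_def] by (rule L2_set_triangle_ineq)
  qed
qed

end

instantiation ell2 :: real_inner
begin

definition inner_ell2 :: "ell2 \<Rightarrow> ell2 \<Rightarrow> real" where
  "inner u v = (\<Sum>i. coord u i * coord v i)"

instance
proof
  fix u v w :: ell2 and r :: real
  show "inner u v = inner v u" by (simp add: inner_ell2_def mult.commute)
  show "inner (u + v) w = inner u w + inner v w"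
    by (simp add: inner_ell2_def coord_simps distrib_right suminf_add summable_coord_mult)
  show "inner (r *\<^sub>R u) v = r * inner u v"
    by (simp add: inner_ell2_def coord_simps mult.assoc suminf_mult summable_coord_mult)
  show norm_eq: "norm u = sqrt (inner u u)"
    by (simp add: norm_ell2_def inner_ell2_def power2_eq_square)
  show nonneg: "0 \<le> inner u u"
    by (simp add: inner_ell2_def suminf_nonneg summable_coord_mult)
  show "inner u u = 0 \<longleftrightarrow> u = 0"
    using norm_eq nonneg norm_eq_zero[of u] by simp
qed

end

section \<open>Metric measure spaces and the doubly centered kernel\<close>

locale metric_measure_space = prob_space M for M :: "'a::metric_space measure" +
  assumes compact_space: "compact (UNIV :: 'a set)"
    and sets_borel: "sets M = sets borel"

definition square_integrable_functions :: "'a measure \<Rightarrow> ('a \<Rightarrow> real) set" where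
  "square_integrable_functions M =
     {g. g \<in> borel_measurable M \<and> integrable M (\<lambda>x. (g x)\<^sup>2)}"

definition kernel_A :: "'a::metric_space \<Rightarrow> 'a \<Rightarrow> real" where
  "kernel_A x s = - (1/2) * (dist x s)\<^sup>2"

definition kernel_B :: "'a::metric_space measure \<Rightarrow> 'a \<Rightarrow> 'a \<Rightarrow> real" where
  "kernel_B M x s =
     kernel_A x s - (\<integral>w. kernel_A w s \<partial>M) - (\<integral>z. kernel_A x z \<partial>M)
       + (\<integral>(w, z). kernel_A w z \<partial>(M \<Otimes>\<^sub>M M))"

definition integral_operator ::
    "'a measure \<Rightarrow> ('a \<Rightarrow> 'a \<Rightarrow> real) \<Rightarrow> ('a \<Rightarrow> real) \<Rightarrow> 'a \<Rightarrow> real" where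
  "integral_operator M K \<phi> x = (\<integral>s. K x s * \<phi> s \<partial>M)"

text \<open>Elements of \<open>L\<^sup>2\<close> are represented by functions; equality in \<open>L\<^sup>2\<close> is equality almost
  everywhere.\<close>

definition is_eigenfunction ::
    "'a measure \<Rightarrow> ('a \<Rightarrow> 'a \<Rightarrow> real) \<Rightarrow> real \<Rightarrow> ('a \<Rightarrow> real) \<Rightarrow> bool" where
  "is_eigenfunction M K r \<phi> \<longleftrightarrow>
     \<phi> \<in> square_integrable_functions M \<and> \<not> (AE x in M. \<phi> x = 0) \<and>
     (AE x in M. integral_operator M K \<phi> x = r * \<phi> x)"

text \<open>The sequence \<open>lam\<close> lists the positive eigenvalues with multiplicity in non-increasing order, and
  \<open>\<phi>\<close> lists corresponding orthonormal eigenfunctions. If there are only finitely many positive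
  eigenvalues, the remaining entries of \<open>lam\<close> are nonpositive and are otherwise unconstrained, as are
  the corresponding entries of \<open>\<phi>\<close>: they do not contribute to the embedding. The last clause says that
  the eigenfunctions listed for \<open>r\<close> span the eigenspace of \<open>r\<close>; their index set is finite because the
  operator is Hilbert--Schmidt.\<close>

definition lists_positive_eigenpairs ::
    "'a measure \<Rightarrow> ('a \<Rightarrow> 'a \<Rightarrow> real) \<Rightarrow> (nat \<Rightarrow> real) \<Rightarrow> (nat \<Rightarrow> 'a \<Rightarrow> real) \<Rightarrow> bool" where
  "lists_positive_eigenpairs M K lam \<phi> \<longleftrightarrow>
     decseq lam \<and>
     (\<forall>i. 0 < lam i \<longrightarrow> is_eigenfunction M K (lam i) (\<phi> i)) \<and>
     (\<forall>i j. 0 < lam i \<longrightarrow> 0 < lam j \<longrightarrow> (\<integral>x. \<phi> i x * \<phi> j x \<partial>M) = (if i = j then 1 else 0)) \<and>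
     (\<forall>r \<psi>. 0 < r \<longrightarrow> is_eigenfunction M K r \<psi> \<longrightarrow>
        (\<exists>c. AE x in M. \<psi> x = (\<Sum>i | lam i = r. c i * \<phi> i x)))"

section \<open>Strain and the MDS embedding\<close>

definition kernel_strain :: "'a::metric_space measure \<Rightarrow> ('a \<Rightarrow> 'a \<Rightarrow> real) \<Rightarrow> real" where
  "kernel_strain M B = (\<integral>x. (\<integral>t. (kernel_B M x t - B x t)\<^sup>2 \<partial>M) \<partial>M)"

definition strain :: "'a::metric_space measure \<Rightarrow> ('a \<Rightarrow> 'b::real_inner) \<Rightarrow> real" where
  "strain M f = kernel_strain M (\<lambda>x t. inner (f x) (f t))"

definition admissible :: "'a measure \<Rightarrow> ('a \<Rightarrow> 'b::real_inner) \<Rightarrow> bool" where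
  "admissible M f \<longleftrightarrow>
     f \<in> borel_measurable M \<and>
     (\<lambda>(x, t). inner (f x) (f t)) \<in> square_integrable_functions (M \<Otimes>\<^sub>M M)"

definition mds_coord :: "(nat \<Rightarrow> real) \<Rightarrow> (nat \<Rightarrow> 'a \<Rightarrow> real) \<Rightarrow> nat \<Rightarrow> 'a \<Rightarrow> real" where
  "mds_coord lam \<phi> i x = sqrt (max (lam i) 0) * \<phi> i x"

text \<open>Such a map exists only if the sequence of coordinates is square-summable at every point. As each
  \<open>\<phi> i\<close> may be changed on a null set, square-summability at almost every point is enough for some
  choice of representatives.\<close>

definition is_mds_embedding ::
    "(nat \<Rightarrow> real) \<Rightarrow> (nat \<Rightarrow> 'a \<Rightarrow> real) \<Rightarrow> ('a \<Rightarrow> ell2) \<Rightarrow> bool" where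
  "is_mds_embedding lam \<phi> f \<longleftrightarrow> (\<forall>x i. coord (f x) i = mds_coord lam \<phi> i x)"

text \<open>The bijection \<open>\<iota>\<close> numbers the coordinates of \<open>\<real>\<^sup>m\<close> by \<open>0, \<dots>, m - 1\<close>, where \<open>m = CARD('m)\<close>.\<close>

definition mds_embedding_Rm ::
    "('m::finite \<Rightarrow> nat) \<Rightarrow> (nat \<Rightarrow> real) \<Rightarrow> (nat \<Rightarrow> 'a \<Rightarrow> real) \<Rightarrow> 'a \<Rightarrow> real ^ 'm" where
  "mds_embedding_Rm \<iota> lam \<phi> x = (\<chi> k. mds_coord lam \<phi> (\<iota> k) x)"

text \<open>The inner product kernel of the MDS embedding as an element of \<open>L\<^sup>2\<close>, that is, the kernel of the
  operator \<open>\<Sum>i. max (lam i) 0 \<cdot> (\<phi> i \<otimes> \<phi> i)\<close>. It is meaningful even if the coordinate sequences are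
  not square-summable, since only the squares of the eigenvalues need to be summable.\<close>

definition is_mds_kernel ::
    "'a measure \<Rightarrow> (nat \<Rightarrow> real) \<Rightarrow> (nat \<Rightarrow> 'a \<Rightarrow> real) \<Rightarrow> ('a \<Rightarrow> 'a \<Rightarrow> real) \<Rightarrow> bool" where
  "is_mds_kernel M lam \<phi> B \<longleftrightarrow>
     (\<lambda>(x, t). B x t) \<in> square_integrable_functions (M \<Otimes>\<^sub>M M) \<and>
     (\<lambda>n. \<integral>(x, t). (B x t - (\<Sum>i<n. mds_coord lam \<phi> i x * mds_coord lam \<phi> i t))\<^sup>2 \<partial>(M \<Otimes>\<^sub>M M))
       \<longlonglongrightarrow> 0"

end

theory Submission
  imports Defs "HOL-Complex_Analysis.Great_Picard"
begin

text \<open>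
Let \<open>L i\<close> be the positive parts of the eigenvalues of \<open>K\<close>, in non-increasing order. Maximizing the
Rayleigh quotient on the orthogonal complement of the first \<open>n\<close> eigenfunctions yields
\<open>\<langle>K \<psi>, \<psi>\<rangle> \<le> (\<Sum>i<n. L i * \<langle>\<psi>, \<phi> i\<rangle>\<^sup>2) + L n * \<parallel>\<psi>\<parallel>\<^sup>2\<close>; a maximizer exists because the kernel is Lipschitz, so
that its operator maps bounded sequences of \<open>L\<^sup>2\<close> to equicontinuous ones. For a kernel
\<open>C = (\<Sum>k<p. h k \<otimes> h k)\<close> this reduces the bound \<open>2 * \<langle>K, C\<rangle> - \<parallel>C\<parallel>\<^sup>2 \<le> (\<Sum>i<p. (L i)\<^sup>2)\<close> to an
inequality for Gram matrices of rank at most \<open>p\<close>. Hence \<open>\<parallel>K - C\<parallel>\<^sup>2 \<ge> \<parallel>K\<parallel>\<^sup>2 - (\<Sum>i<p. (L i)\<^sup>2)\<close>, and the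
MDS kernel attains the bound. Inner product kernels of maps whose coordinates are not square
integrable, or that have infinitely many coordinates, are \<open>L\<^sup>2\<close>-limits of such \<open>C\<close>.
\<close>

section \<open>Orthonormal systems in an inner product space\<close>

text \<open>An inner product kernel is positive semidefinite, so a competitor can gain only from the
  positive spectrum of \<open>K\<close>. A one-sided bound on the quadratic form is therefore all
  that is asked of the operator; no eigenfunction expansion of \<open>K\<close> itself appears. The
  gain is \<open>2 * \<langle>K, C\<rangle> - \<parallel>C\<parallel>\<^sup>2\<close> because
  expanding the squared distance of \<open>K\<close> and \<open>C\<close> leaves exactly this
  quantity to subtract from the squared norm of \<open>K\<close>. Two indices must be kept apart:
  \<open>p\<close> is the rank of the competitor, while \<open>n\<close> counts auxiliary
  eigenfunctions and tends to infinity. The error term with \<open>L n\<close> then disappears,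
  since the squares of the \<open>L i\<close> are summable. Functions stand for classes in L2, so
  their pairing is only semidefinite and they do not form an instance of \<open>real_inner\<close>.
  Hence the Gram matrix inequality is proved in an arbitrary inner product space and applied to
  coefficient vectors in \<open>ell2\<close>. The coordinates of the MDS embedding need not be
  square-summable at a point. The infinite-dimensional minimum is therefore also obtained for the
  L2-limit of the finite-rank MDS kernels.\<close>

text \<open>With \<open>y\<close> the projection of \<open>x\<close>, both \<open>inner x y\<close>
  and \<open>inner y y\<close> equal the sum of squared coefficients, so the claim is nonnegativity
  of the squared norm of \<open>x - y\<close>. An indexed family covers both later uses: the vectors
  \<open>d i\<close>, and an orthonormal set indexed by itself.\<close>

lemma Bessel_inequality:
  fixes d :: "'i \<Rightarrow> 'b::real_inner"
  assumes "finite I"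
    and orth: "\<And>i j. i \<in> I \<Longrightarrow> j \<in> I \<Longrightarrow> inner (d i) (d j) = (if i = j then 1 else 0)"
  shows "(\<Sum>i\<in>I. (inner x (d i))\<^sup>2) \<le> inner x x"
proof -
  define y where "y = (\<Sum>i\<in>I. inner x (d i) *\<^sub>R d i)"
  have xy: "inner x y = (\<Sum>i\<in>I. (inner x (d i))\<^sup>2)"
    by (simp add: y_def inner_sum_right power2_eq_square)
  have "inner y y = (\<Sum>i\<in>I. \<Sum>j\<in>I. inner x (d i) * (inner x (d j) * inner (d i) (d j)))"
    by (simp add: y_def inner_sum_left inner_sum_right sum_distrib_left)
      (subst sum.swap, simp add: inner_commute ac_simps)
  also have "\<dots> = (\<Sum>i\<in>I. \<Sum>j\<in>I. if i = j then (inner x (d i))\<^sup>2 else 0)"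
    by (intro sum.cong refl) (simp add: orth power2_eq_square)
  also have "\<dots> = (\<Sum>i\<in>I. (inner x (d i))\<^sup>2)"
    using \<open>finite I\<close> by simp
  finally have yy: "inner y y = (\<Sum>i\<in>I. (inner x (d i))\<^sup>2)" .
  have "0 \<le> inner (x - y) (x - y)" by simp
  also have "\<dots> = inner x x - 2 * inner x y + inner y y"
    by (simp add: inner_diff_left inner_diff_right inner_commute)
  finally show ?thesis using xy yy by simp
qed

text \<open>The bound on \<open>card E\<close> is what matters: through it the rank \<open>p\<close>
  of a competitor enters the estimate.\<close>

lemma orthonormal_spanning_set:
  fixes A :: "'b::real_inner set"
  assumes "finite A"
  obtains E where "finite E" "card E \<le> card A"
    and "\<And>e f. e \<in> E \<Longrightarrow> f \<in> E \<Longrightarrow> inner e f = (if e = f then 1 else 0)"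
    and "\<And>x. x \<in> A \<Longrightarrow> x = (\<Sum>e\<in>E. inner x e *\<^sub>R e)"
proof -
  obtain C where C: "finite C" "card C \<le> card A" "span C = span A" "pairwise orthogonal C"
    using basis_orthogonal[OF assms] by blast
  \<comment> \<open>Zero may belong to an orthogonal set and cannot be normalized, so it is
    removed.\<close>
  define E where "E = (\<lambda>c. c /\<^sub>R norm c) ` (C - {0})"
  have "finite E" using C(1) by (simp add: E_def)
  have "card E \<le> card A"
    using card_image_le[of "C - {0}" "\<lambda>c. c /\<^sub>R norm c"] card_mono[of C "C - {0}"] C
    unfolding E_def by (meson Diff_subset dual_order.trans finite_Diff)
  have orth: "inner e f = (if e = f then 1 else 0)" if ef: "e \<in> E" "f \<in> E" for e f
  proof -
    obtain c c' where c: "c \<in> C" "c \<noteq> 0" "e = c /\<^sub>R norm c"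
      "c' \<in> C" "c' \<noteq> 0" "f = c' /\<^sub>R norm c'"
      using ef by (auto simp: E_def)
    show ?thesis
    proof (cases "c = c'")
      case True
      then show ?thesis using c
        by (simp add: dot_square_norm power2_eq_square)
    next
      case False
      then have "inner c c' = 0" using C(4) c unfolding pairwise_def orthogonal_def by blast
      then have "inner e f = 0" using c by simp
      moreover have "norm e = 1" using c by simp
      then have "e \<noteq> f" using \<open>inner e f = 0\<close> by (auto simp: dot_square_norm)
      ultimately show ?thesis by simp
    qed
  qed
  have exp: "x = (\<Sum>e\<in>E. inner x e *\<^sub>R e)" if "x \<in> A" for x
  proof -
    have "x \<in> span E"
    proof -
      have "c \<in> span E" if "c \<in> C" for c
      proof (cases "c = 0")
        case False
        then have "c /\<^sub>R norm c \<in> span E"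
          using that by (intro span_base) (auto simp: E_def)
        then have "norm c *\<^sub>R (c /\<^sub>R norm c) \<in> span E" by (rule span_scale)
        then show ?thesis using False by simp
      qed (simp add: span_zero)
      then have "span C \<subseteq> span E" by (intro span_minimal) auto
      then show ?thesis using C(3) span_base[OF that] by auto
    qed
    then obtain u where u: "x = (\<Sum>e\<in>E. u e *\<^sub>R e)"
      using span_finite[OF \<open>finite E\<close>] by auto
    have "inner x f = u f" if "f \<in> E" for f
    proof -
      have "inner x f = (\<Sum>e\<in>E. u e * inner e f)" by (simp add: u inner_sum_left)
      also have "\<dots> = (\<Sum>e\<in>E. if e = f then u e else 0)"
        using that by (intro sum.cong refl) (simp add: orth)
      also have "\<dots> = u f" using \<open>finite E\<close> that by simp
      finally show ?thesis .
    qed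
    then show ?thesis using u by simp
  qed
  show thesis by (rule that[OF \<open>finite E\<close> \<open>card E \<le> card A\<close> orth exp])
qed

text \<open>Weights in [0, 1] of total mass at most \<open>p\<close> are best spent on the
  \<open>p\<close> largest values. After subtracting \<open>v p\<close>, indices below
  \<open>p\<close> contribute most with weight 1 and the others with weight 0; the subtracted part
  is controlled by the total mass because \<open>v p\<close> is nonnegative.\<close>

lemma sum_weighted_le_sum_first:
  fixes v w :: "nat \<Rightarrow> real"
  assumes "decseq v" and v0: "\<And>i. 0 \<le> v i"
    and w: "\<And>i. i < n \<Longrightarrow> 0 \<le> w i" "\<And>i. i < n \<Longrightarrow> w i \<le> 1" "(\<Sum>i<n. w i) \<le> real p"
  shows "(\<Sum>i<n. v i * w i) \<le> (\<Sum>i<p. v i)"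
proof -
  have "(\<Sum>i<n. (v i - v p) * w i) \<le> (\<Sum>i<n. if i < p then v i - v p else 0)"
  proof (rule sum_mono)
    fix i assume i: "i \<in> {..<n}"
    show "(v i - v p) * w i \<le> (if i < p then v i - v p else 0)"
    proof (cases "i < p")
      case True
      then have "0 \<le> v i - v p" using \<open>decseq v\<close> by (simp add: decseqD)
      then show ?thesis using True mult_left_mono[OF w(2)[of i], of "v i - v p"] i by simp
    next
      case False
      then have "v i - v p \<le> 0" using \<open>decseq v\<close> by (simp add: decseqD)
      then show ?thesis using False w(1)[of i] i by (simp add: mult_nonpos_nonneg)
    qed
  qed
  also have "\<dots> = (\<Sum>i\<in>{..<n} \<inter> {..<p}. v i - v p)"
    by (simp add: sum.If_cases Int_def lessThan_def)
  also have "\<dots> \<le> (\<Sum>i<p. v i - v p)"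
    by (rule sum_mono2) (use \<open>decseq v\<close> in \<open>auto simp: decseqD\<close>)
  also have "\<dots> = (\<Sum>i<p. v i) - p * v p" by (simp add: sum_subtractf)
  finally have "(\<Sum>i<n. v i * w i) - v p * (\<Sum>i<n. w i) \<le> (\<Sum>i<p. v i) - p * v p"
    by (simp add: left_diff_distrib sum_subtractf sum_distrib_left)
  moreover have "v p * (\<Sum>i<n. w i) \<le> v p * p" using w(3) v0 by (intro mult_left_mono)
  ultimately show ?thesis by (simp add: mult.commute)
qed

text \<open>Let \<open>S\<close> be the matrix of the sum of the rank-one operators of the
  \<open>a k\<close> in the basis \<open>E\<close> of their span, and \<open>D\<close> that of the
  operator with eigenvalues \<open>L i\<close> on \<open>d i\<close>, compressed to this span.
  Completing the square bounds twice the pairing of \<open>S\<close> and \<open>D\<close> minus the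
  squared norm of \<open>S\<close> by the squared norm of \<open>D\<close>. The latter is at most a
  weighted sum of the squares of the \<open>L i\<close>, with weights in [0, 1] of total mass at
  most \<open>p\<close>.\<close>

lemma Gram_trace_inequality:
  fixes a d :: "nat \<Rightarrow> 'b::real_inner" and L :: "nat \<Rightarrow> real"
  assumes orth: "\<And>i j. i < n \<Longrightarrow> j < n \<Longrightarrow> inner (d i) (d j) = (if i = j then 1 else 0)"
    and "decseq L" and L0: "\<And>i. 0 \<le> L i"
  shows "2 * (\<Sum>k<p. \<Sum>i<n. L i * (inner (a k) (d i))\<^sup>2) - (\<Sum>k<p. \<Sum>l<p. (inner (a k) (a l))\<^sup>2)
    \<le> (\<Sum>i<p. (L i)\<^sup>2)"
proof -
  obtain E where E: "finite E" "card E \<le> card (a ` {..<p})"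
    and orthE: "\<And>e f. e \<in> E \<Longrightarrow> f \<in> E \<Longrightarrow> inner e f = (if e = f then 1 else 0)"
    and exp: "\<And>x. x \<in> a ` {..<p} \<Longrightarrow> x = (\<Sum>e\<in>E. inner x e *\<^sub>R e)"
    using orthonormal_spanning_set[of "a ` {..<p}"] by blast
  have cardE: "card E \<le> p" using E(2) card_image_le[of "{..<p}" a] by simp
  have inner_a: "inner (a k) x = (\<Sum>e\<in>E. inner (a k) e * inner x e)" if "k < p" for k x
  proof -
    have "inner (a k) x = inner (\<Sum>e\<in>E. inner (a k) e *\<^sub>R e) x"
      using exp[of "a k"] that by simp
    also have "\<dots> = (\<Sum>e\<in>E. inner (a k) e * inner e x)"
      by (simp add: inner_sum_left)
    finally show ?thesis by (simp only: inner_commute)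
  qed
  define S where "S e f = (\<Sum>k<p. inner (a k) e * inner (a k) f)" for e f
  define D where "D e f = (\<Sum>i<n. L i * (inner (d i) e * inner (d i) f))" for e f
  have 1: "(\<Sum>k<p. \<Sum>i<n. L i * (inner (a k) (d i))\<^sup>2) = (\<Sum>e\<in>E. \<Sum>f\<in>E. S e f * D e f)"
  proof -
    have "(\<Sum>k<p. \<Sum>i<n. L i * (inner (a k) (d i))\<^sup>2)
      = (\<Sum>k<p. \<Sum>i<n. \<Sum>e\<in>E. \<Sum>f\<in>E. (inner (a k) e * inner (a k) f) * (L i * (inner (d i) e * inner (d i) f)))"
    proof (intro sum.cong refl)
      fix k i assume "k \<in> {..<p}"
      then have k: "k < p" by simp
      show "L i * (inner (a k) (d i))\<^sup>2
        = (\<Sum>e\<in>E. \<Sum>f\<in>E. (inner (a k) e * inner (a k) f) * (L i * (inner (d i) e * inner (d i) f)))"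
        unfolding power2_eq_square inner_a[OF k, of "d i"] sum_product
        by (simp add: sum_distrib_left ac_simps)
    qed
    also have "\<dots> = (\<Sum>k<p. \<Sum>e\<in>E. \<Sum>f\<in>E. \<Sum>i<n. (inner (a k) e * inner (a k) f) * (L i * (inner (d i) e * inner (d i) f)))"
      by (simp only: sum.swap[of _ "{..<n}" E])
    also have "\<dots> = (\<Sum>k<p. \<Sum>e\<in>E. \<Sum>f\<in>E. (inner (a k) e * inner (a k) f) * D e f)"
      by (simp add: D_def sum_distrib_left)
    also have "\<dots> = (\<Sum>e\<in>E. \<Sum>f\<in>E. \<Sum>k<p. (inner (a k) e * inner (a k) f) * D e f)"
      by (simp only: sum.swap[of _ "{..<p}" E])
    also have "\<dots> = (\<Sum>e\<in>E. \<Sum>f\<in>E. S e f * D e f)"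
      by (simp add: S_def sum_distrib_right)
    finally show ?thesis .
  qed
  \<comment> \<open>The Gram matrix of the \<open>a k\<close> and \<open>S\<close> are the two
    products of a coefficient matrix with its transpose, so their Hilbert-Schmidt norms
    agree.\<close>
  have 2: "(\<Sum>k<p. \<Sum>l<p. (inner (a k) (a l))\<^sup>2) = (\<Sum>e\<in>E. \<Sum>f\<in>E. (S e f)\<^sup>2)"
  proof -
    have "(\<Sum>k<p. \<Sum>l<p. (inner (a k) (a l))\<^sup>2)
      = (\<Sum>k<p. \<Sum>l<p. \<Sum>e\<in>E. \<Sum>f\<in>E. (inner (a k) e * inner (a k) f) * (inner (a l) e * inner (a l) f))"
    proof (intro sum.cong refl)
      fix k l assume "k \<in> {..<p}"
      then have k: "k < p" by simp
      show "(inner (a k) (a l))\<^sup>2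
        = (\<Sum>e\<in>E. \<Sum>f\<in>E. (inner (a k) e * inner (a k) f) * (inner (a l) e * inner (a l) f))"
        unfolding power2_eq_square inner_a[OF k, of "a l"] sum_product
        by (intro sum.cong refl) (simp add: ac_simps)
    qed
    also have "\<dots> = (\<Sum>e\<in>E. \<Sum>f\<in>E. \<Sum>k<p. \<Sum>l<p. (inner (a k) e * inner (a k) f) * (inner (a l) e * inner (a l) f))"
      by (simp only: sum.swap[of _ "{..<p}" E])
    also have "\<dots> = (\<Sum>e\<in>E. \<Sum>f\<in>E. (S e f)\<^sup>2)"
      by (simp add: S_def power2_eq_square sum_product)
    finally show ?thesis .
  qed
  \<comment> \<open>\<open>y e\<close> is the image of \<open>e\<close> under the uncompressed
    operator. Bessel's inequality for \<open>E\<close> then discards its component orthogonal to the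
    span.\<close>
  define y where "y e = (\<Sum>i<n. (L i * inner e (d i)) *\<^sub>R d i)" for e
  have Dy: "D e f = inner (y e) f" for e f
    by (simp add: D_def y_def inner_sum_left inner_commute[of e] ac_simps)
  have yy: "inner (y e) (y e) = (\<Sum>i<n. (L i)\<^sup>2 * (inner e (d i))\<^sup>2)" for e
  proof -
    have yd: "inner (y e) (d i) = L i * inner e (d i)" if "i < n" for i
    proof -
      have "inner (y e) (d i) = (\<Sum>j<n. if j = i then L i * inner e (d i) else 0)"
        unfolding y_def inner_sum_left by (intro sum.cong refl) (auto simp: orth that)
      then show ?thesis using that by simp
    qed
    have "inner (y e) (y e) = (\<Sum>i<n. (L i * inner e (d i)) * inner (y e) (d i))"
      by (subst (2) y_def) (simp add: inner_sum_right)
    then show ?thesis by (simp add: yd power2_eq_square ac_simps)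
  qed
  have "2 * (\<Sum>e\<in>E. \<Sum>f\<in>E. S e f * D e f) - (\<Sum>e\<in>E. \<Sum>f\<in>E. (S e f)\<^sup>2)
      = (\<Sum>e\<in>E. \<Sum>f\<in>E. 2 * S e f * D e f - (S e f)\<^sup>2)"
    by (simp add: sum_subtractf sum_distrib_left ac_simps)
  also have "\<dots> \<le> (\<Sum>e\<in>E. \<Sum>f\<in>E. (inner (y e) f)\<^sup>2)"
  proof (intro sum_mono)
    fix e f
    have "0 \<le> (S e f - D e f)\<^sup>2" by simp
    then show "2 * S e f * D e f - (S e f)\<^sup>2 \<le> (inner (y e) f)\<^sup>2"
      by (simp add: Dy power2_diff)
  qed
  also have "\<dots> \<le> (\<Sum>e\<in>E. \<Sum>i<n. (L i)\<^sup>2 * (inner e (d i))\<^sup>2)"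
    unfolding yy[symmetric]
    by (intro sum_mono Bessel_inequality[where d="\<lambda>e. e"] E(1)) (simp add: orthE)
  also have "\<dots> = (\<Sum>i<n. (L i)\<^sup>2 * (\<Sum>e\<in>E. (inner e (d i))\<^sup>2))"
    by (subst sum.swap) (simp add: sum_distrib_left)
  \<comment> \<open>The weight of index \<open>i\<close> is the squared length of the projection of
    \<open>d i\<close> to the span of \<open>E\<close>. Bessel for \<open>E\<close> bounds each
    weight by 1; Bessel for the \<open>d i\<close>, summed over \<open>E\<close>, bounds their total
    by \<open>card E\<close>.\<close>
  also have "\<dots> \<le> (\<Sum>i<p. (L i)\<^sup>2)"
  proof (rule sum_weighted_le_sum_first)
    show "decseq (\<lambda>i. (L i)\<^sup>2)"
      using \<open>decseq L\<close> L0 by (auto simp: decseq_def intro: power_mono)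
    fix i assume i: "i < n"
    have "(\<Sum>e\<in>E. (inner (d i) e)\<^sup>2) \<le> inner (d i) (d i)"
      by (intro Bessel_inequality[where d="\<lambda>e. e"] E(1)) (simp add: orthE)
    then show "(\<Sum>e\<in>E. (inner e (d i))\<^sup>2) \<le> 1" using i by (simp add: orth inner_commute)
  next
    have "(\<Sum>i<n. \<Sum>e\<in>E. (inner e (d i))\<^sup>2) = (\<Sum>e\<in>E. \<Sum>i<n. (inner e (d i))\<^sup>2)"
      by (rule sum.swap)
    also have "\<dots> \<le> (\<Sum>e\<in>E. inner e e)"
      by (intro sum_mono Bessel_inequality) (auto simp: orth)
    also have "\<dots> = card E" by (simp add: orthE)
    finally show "(\<Sum>i<n. \<Sum>e\<in>E. (inner e (d i))\<^sup>2) \<le> real p" using cardE by simp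
  qed (auto intro: sum_nonneg)
  finally show ?thesis unfolding 1 2 .
qed

text \<open>These vectors serve twice: as a concrete orthonormal family for
  \<open>Gram_trace_inequality\<close>, and as continuous functionals that read off
  coordinates.\<close>

definition unit_ell2 :: "nat \<Rightarrow> ell2" where
  "unit_ell2 i = Abs_ell2 (\<lambda>j. if j = i then 1 else 0)"

lemma coord_unit_ell2: "coord (unit_ell2 i) j = (if j = i then 1 else 0)"
proof -
  have "summable (\<lambda>j. (if j = i then 1 else 0 :: real)\<^sup>2)"
    by (rule summable_finite[of "{i}"]) auto
  then show ?thesis by (simp add: unit_ell2_def Abs_ell2_inverse)
qed

lemma inner_unit_ell2: "inner u (unit_ell2 i) = coord u i"
proof -
  have "inner u (unit_ell2 i) = (\<Sum>j\<in>{i}. coord u j * coord (unit_ell2 i) j)"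
    unfolding inner_ell2_def by (rule suminf_finite) (auto simp: coord_unit_ell2)
  then show ?thesis by (simp add: coord_unit_ell2)
qed

section \<open>Square-integrable functions\<close>

abbreviation L2 :: "'a measure \<Rightarrow> ('a \<Rightarrow> real) set" where
  "L2 \<equiv> square_integrable_functions"

text \<open>A semidefinite form on functions: it vanishes on null functions, and the integral has
  value 0 where the product is not integrable. This is why additivity rules carry membership in
  \<open>L2\<close> while homogeneity and symmetry hold outright.\<close>

definition l2_inner :: "'a measure \<Rightarrow> ('a \<Rightarrow> real) \<Rightarrow> ('a \<Rightarrow> real) \<Rightarrow> real" where
  "l2_inner N f g = (\<integral>x. f x * g x \<partial>N)"

lemma L2_measurable: "f \<in> L2 N \<Longrightarrow> f \<in> borel_measurable N"
  by (simp add: square_integrable_functions_def)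

lemma L2_integrable_square: "f \<in> L2 N \<Longrightarrow> integrable N (\<lambda>x. (f x)\<^sup>2)"
  by (simp add: square_integrable_functions_def)

lemma L2_I: "f \<in> borel_measurable N \<Longrightarrow> integrable N (\<lambda>x. (f x)\<^sup>2) \<Longrightarrow> f \<in> L2 N"
  by (simp add: square_integrable_functions_def)

lemma L2_integrable_mult:
  assumes "f \<in> L2 N" and "g \<in> L2 N"
  shows "integrable N (\<lambda>x. f x * g x)"
proof (rule Bochner_Integration.integrable_bound)
  show "integrable N (\<lambda>x. (f x)\<^sup>2 + (g x)\<^sup>2)"
    using assms by (intro Bochner_Integration.integrable_add L2_integrable_square)
  show "(\<lambda>x. f x * g x) \<in> borel_measurable N"
    using assms[THEN L2_measurable] by measurable
  have "\<bar>a * b\<bar> \<le> a\<^sup>2 + b\<^sup>2" for a b :: real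
  proof -
    have "0 \<le> (a + b)\<^sup>2 + a\<^sup>2 + b\<^sup>2" "0 \<le> (a - b)\<^sup>2 + a\<^sup>2 + b\<^sup>2" by simp_all
    then have "- (a * b) \<le> a\<^sup>2 + b\<^sup>2" "a * b \<le> a\<^sup>2 + b\<^sup>2"
      by (simp_all add: power2_sum power2_diff)
    then show ?thesis by (simp add: abs_le_iff)
  qed
  then show "AE x in N. norm (f x * g x) \<le> norm ((f x)\<^sup>2 + (g x)\<^sup>2)"
    by simp
qed

lemma L2_cmult: "f \<in> L2 N \<Longrightarrow> (\<lambda>x. c * f x) \<in> L2 N"
  by (rule L2_I) (auto simp: power_mult_distrib dest: L2_measurable L2_integrable_square)

lemma L2_add:
  assumes "f \<in> L2 N" and "g \<in> L2 N" shows "(\<lambda>x. f x + g x) \<in> L2 N"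
proof (rule L2_I)
  show "(\<lambda>x. f x + g x) \<in> borel_measurable N"
    using assms[THEN L2_measurable] by measurable
  show "integrable N (\<lambda>x. (f x + g x)\<^sup>2)"
    unfolding power2_sum mult.assoc using assms
    by (intro Bochner_Integration.integrable_add L2_integrable_square integrable_mult_right L2_integrable_mult)
qed

lemma L2_diff: "f \<in> L2 N \<Longrightarrow> g \<in> L2 N \<Longrightarrow> (\<lambda>x. f x - g x) \<in> L2 N"
  using L2_add[of f N "\<lambda>x. -1 * g x"] L2_cmult[of g N "-1"] by simp

lemma L2_zero: "(\<lambda>x. 0) \<in> L2 N"
  by (rule L2_I) auto

lemma L2_sum: "(\<And>i. i \<in> I \<Longrightarrow> f i \<in> L2 N) \<Longrightarrow> (\<lambda>x. \<Sum>i\<in>I. f i x) \<in> L2 N"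
  by (induction I rule: infinite_finite_induct) (auto simp: L2_zero L2_add)

lemma L2_bounded:
  assumes "finite_measure N" and f: "f \<in> borel_measurable N" and "\<And>x. \<bar>f x\<bar> \<le> c"
  shows "f \<in> L2 N"
proof (rule L2_I[OF f])
  interpret finite_measure N by fact
  show "integrable N (\<lambda>x. (f x)\<^sup>2)"
    by (rule integrable_const_bound[where B="c\<^sup>2"])
      (use f assms(3) in \<open>auto simp: abs_le_square_iff[symmetric] intro: order_trans[OF _ abs_ge_self]\<close>)
qed

section \<open>Algebra of the L2 pairing and convergence in L2\<close>

lemma l2_inner_commute: "l2_inner N f g = l2_inner N g f"
  by (simp add: l2_inner_def mult.commute)

lemma l2_inner_nonneg: "0 \<le> l2_inner N f f"
  by (simp add: l2_inner_def)

lemma l2_inner_cmult_left: "l2_inner N (\<lambda>x. c * f x) g = c * l2_inner N f g"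
  by (simp add: l2_inner_def mult.assoc)

lemma l2_inner_cmult_right: "l2_inner N g (\<lambda>x. c * f x) = c * l2_inner N g f"
  by (simp add: l2_inner_def mult.left_commute)

lemma l2_inner_add_left:
  "f \<in> L2 N \<Longrightarrow> g \<in> L2 N \<Longrightarrow> h \<in> L2 N \<Longrightarrow>
    l2_inner N (\<lambda>x. f x + g x) h = l2_inner N f h + l2_inner N g h"
  by (simp add: l2_inner_def distrib_right L2_integrable_mult)

lemma l2_inner_diff_left:
  "f \<in> L2 N \<Longrightarrow> g \<in> L2 N \<Longrightarrow> h \<in> L2 N \<Longrightarrow>
    l2_inner N (\<lambda>x. f x - g x) h = l2_inner N f h - l2_inner N g h"
  by (simp add: l2_inner_def left_diff_distrib L2_integrable_mult)

lemma l2_inner_diff_right: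
  "f \<in> L2 N \<Longrightarrow> g \<in> L2 N \<Longrightarrow> h \<in> L2 N \<Longrightarrow>
    l2_inner N h (\<lambda>x. f x - g x) = l2_inner N h f - l2_inner N h g"
  by (simp add: l2_inner_commute[of N h] l2_inner_diff_left)

lemma l2_inner_sum_left:
  "(\<And>i. i \<in> I \<Longrightarrow> f i \<in> L2 N) \<Longrightarrow> h \<in> L2 N \<Longrightarrow>
    l2_inner N (\<lambda>x. \<Sum>i\<in>I. f i x) h = (\<Sum>i\<in>I. l2_inner N (f i) h)"
  by (simp add: l2_inner_def sum_distrib_right L2_integrable_mult)

lemma l2_inner_sum_right:
  "(\<And>i. i \<in> I \<Longrightarrow> f i \<in> L2 N) \<Longrightarrow> h \<in> L2 N \<Longrightarrow>
    l2_inner N h (\<lambda>x. \<Sum>i\<in>I. f i x) = (\<Sum>i\<in>I. l2_inner N h (f i))"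
  by (simp add: l2_inner_commute[of N h] l2_inner_sum_left)

lemma l2_inner_diff_self:
  "f \<in> L2 N \<Longrightarrow> g \<in> L2 N \<Longrightarrow>
    l2_inner N (\<lambda>x. f x - g x) (\<lambda>x. f x - g x) =
      l2_inner N f f - 2 * l2_inner N f g + l2_inner N g g"
  by (simp add: l2_inner_diff_left l2_inner_diff_right L2_diff l2_inner_commute[of N g f])

text \<open>The polynomial \<open>q\<close> in \<open>t\<close> is the squared norm of
  \<open>f - t * g\<close>, hence nonnegative. Vanishing norm of \<open>g\<close> does not make
  \<open>g\<close> the zero function, so this case needs its own argument: \<open>q\<close> is then
  affine in \<open>t\<close>, which forces its slope to vanish.\<close>

lemma l2_inner_Cauchy_Schwarz:
  assumes f: "f \<in> L2 N" and g: "g \<in> L2 N"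
  shows "(l2_inner N f g)\<^sup>2 \<le> l2_inner N f f * l2_inner N g g"
proof -
  have q: "0 \<le> l2_inner N f f - 2 * t * l2_inner N f g + t\<^sup>2 * l2_inner N g g" for t
    using l2_inner_nonneg[of N "\<lambda>x. f x - t * g x"]
      l2_inner_diff_self[OF f L2_cmult[OF g], of t]
    by (simp add: l2_inner_cmult_left l2_inner_cmult_right power2_eq_square algebra_simps)
  show ?thesis
  proof (cases "l2_inner N g g = 0")
    case True
    show ?thesis
    proof (rule ccontr)
      assume "\<not> ?thesis"
      then have nz: "l2_inner N f g \<noteq> 0" using True by auto
      \<comment> \<open>This value of \<open>t\<close> is chosen to make the affine polynomial equal
        to -1.\<close>
      have "0 \<le> l2_inner N f f - 2 * ((l2_inner N f f + 1) / (2 * l2_inner N f g)) * l2_inner N f g"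
        using q[of "(l2_inner N f f + 1) / (2 * l2_inner N f g)"] True by simp
      then show False using nz by simp
    qed
  next
    case False
    then have pos: "0 < l2_inner N g g" using l2_inner_nonneg[of N g] by simp
    have "0 \<le> l2_inner N f f - (l2_inner N f g)\<^sup>2 / l2_inner N g g"
      using q[of "l2_inner N f g / l2_inner N g g"] pos
      by (simp add: power2_eq_square divide_simps split: if_splits)
    then show ?thesis using pos by (simp add: field_simps)
  qed
qed

lemma l2_inner_tendsto_left:
  assumes u: "\<And>n. u n \<in> L2 N" and v: "v \<in> L2 N" and w: "w \<in> L2 N"
    and lim: "(\<lambda>n. l2_inner N (\<lambda>x. u n x - v x) (\<lambda>x. u n x - v x)) \<longlonglongrightarrow> 0"
  shows "(\<lambda>n. l2_inner N (u n) w) \<longlonglongrightarrow> l2_inner N v w"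
proof -
  have "(\<lambda>n. (l2_inner N (\<lambda>x. u n x - v x) w)\<^sup>2) \<longlonglongrightarrow> 0"
  proof (rule tendsto_sandwich[OF _ _ tendsto_const])
    show "(\<lambda>n. l2_inner N (\<lambda>x. u n x - v x) (\<lambda>x. u n x - v x) * l2_inner N w w) \<longlonglongrightarrow> 0"
      using tendsto_mult_right[OF lim, of "l2_inner N w w"] by simp
  qed (auto intro!: always_eventually l2_inner_Cauchy_Schwarz L2_diff u v w)
  then have "(\<lambda>n. l2_inner N (\<lambda>x. u n x - v x) w) \<longlonglongrightarrow> 0"
    using tendsto_real_sqrt by (force simp: tendsto_rabs_zero_iff)
  then have "(\<lambda>n. l2_inner N (u n) w - l2_inner N v w) \<longlonglongrightarrow> 0"
    by (simp add: l2_inner_diff_left u v w)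
  then show ?thesis by (rule LIM_zero_cancel)
qed

lemma l2_inner_self_tendsto:
  assumes u: "\<And>n. u n \<in> L2 N" and v: "v \<in> L2 N"
    and lim: "(\<lambda>n. l2_inner N (\<lambda>x. u n x - v x) (\<lambda>x. u n x - v x)) \<longlonglongrightarrow> 0"
  shows "(\<lambda>n. l2_inner N (u n) (u n)) \<longlonglongrightarrow> l2_inner N v v"
proof -
  have "(\<lambda>n. l2_inner N (\<lambda>x. u n x - v x) (\<lambda>x. u n x - v x) + 2 * l2_inner N (u n) v - l2_inner N v v)
      \<longlonglongrightarrow> 0 + 2 * l2_inner N v v - l2_inner N v v"
    by (intro tendsto_intros lim l2_inner_tendsto_left[OF u v v])
  then show ?thesis by (simp add: l2_inner_diff_self u v)
qed

lemma l2_inner_cong_AE: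
  "f \<in> L2 N \<Longrightarrow> f' \<in> L2 N \<Longrightarrow> g \<in> L2 N \<Longrightarrow> AE x in N. f x = f' x \<Longrightarrow> l2_inner N f g = l2_inner N f' g"
  unfolding l2_inner_def
  by (rule integral_cong_AE) (auto intro: borel_measurable_times dest: L2_measurable)

lemma L2_dominated_convergence:
  assumes "finite_measure N"
    and u: "\<And>n. u n \<in> borel_measurable N" and v: "v \<in> borel_measurable N"
    and bound: "\<And>n x. \<bar>u n x\<bar> \<le> c" and lim: "\<And>x. (\<lambda>n. u n x) \<longlonglongrightarrow> v x"
  shows "(\<lambda>n. l2_inner N (\<lambda>x. u n x - v x) (\<lambda>x. u n x - v x)) \<longlonglongrightarrow> 0"
proof -
  interpret finite_measure N by fact
  have bv: "\<bar>v x\<bar> \<le> c" for x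
    by (rule LIMSEQ_le_const2[OF tendsto_rabs[OF lim]]) (use bound in auto)
  have "(\<lambda>n. \<integral>x. (u n x - v x) * (u n x - v x) \<partial>N) \<longlonglongrightarrow> (\<integral>x. 0 \<partial>N)"
  proof (rule integral_dominated_convergence[where w="\<lambda>_. (2 * c) * (2 * c)"])
    show "AE x in N. (\<lambda>n. (u n x - v x) * (u n x - v x)) \<longlonglongrightarrow> 0"
    proof (rule AE_I2)
      fix x
      have "(\<lambda>n. u n x - v x) \<longlonglongrightarrow> 0" using lim by (rule LIM_zero)
      then show "(\<lambda>n. (u n x - v x) * (u n x - v x)) \<longlonglongrightarrow> 0"
        using tendsto_mult by fastforce
    qed
    fix n
    show "AE x in N. norm ((u n x - v x) * (u n x - v x)) \<le> 2 * c * (2 * c)"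
    proof (rule AE_I2)
      fix x
      have "\<bar>u n x - v x\<bar> \<le> 2 * c"
        using bound[of n x] bv[of x] by linarith
      then show "norm ((u n x - v x) * (u n x - v x)) \<le> 2 * c * (2 * c)"
        using mult_mono[of "\<bar>u n x - v x\<bar>" "2 * c" "\<bar>u n x - v x\<bar>" "2 * c"]
        by (simp add: abs_mult)
    qed
  qed (use u v in auto)
  then show ?thesis by (simp add: l2_inner_def)
qed

text \<open>The parallelogram identity with the squared norm of \<open>f - g\<close>
  discarded.\<close>

lemma l2_inner_add_self_le:
  assumes f: "f \<in> L2 N" and g: "g \<in> L2 N"
  shows "l2_inner N (\<lambda>x. f x + g x) (\<lambda>x. f x + g x) \<le> 2 * l2_inner N f f + 2 * l2_inner N g g"
proof -
  have "l2_inner N h (\<lambda>x. f x + g x) = l2_inner N h f + l2_inner N h g" if "h \<in> L2 N" for h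
    using l2_inner_add_left[OF f g that] by (simp add: l2_inner_commute[of N h])
  then show ?thesis
    using l2_inner_nonneg[of N "\<lambda>x. f x - g x"]
    by (simp add: l2_inner_diff_self f g l2_inner_add_left L2_add l2_inner_commute[of N g f])
qed

lemma l2_dist_tendsto:
  assumes k: "k \<in> L2 N" and u: "\<And>n. u n \<in> L2 N" and v: "v \<in> L2 N"
    and lim: "(\<lambda>n. l2_inner N (\<lambda>x. u n x - v x) (\<lambda>x. u n x - v x)) \<longlonglongrightarrow> 0"
  shows "(\<lambda>n. l2_inner N (\<lambda>x. k x - u n x) (\<lambda>x. k x - u n x))
    \<longlonglongrightarrow> l2_inner N (\<lambda>x. k x - v x) (\<lambda>x. k x - v x)"
proof -
  have "(\<lambda>n. l2_inner N k k - 2 * l2_inner N (u n) k + l2_inner N (u n) (u n))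
    \<longlonglongrightarrow> l2_inner N k k - 2 * l2_inner N v k + l2_inner N v v"
    by (intro tendsto_intros l2_inner_tendsto_left[OF u v k lim] l2_inner_self_tendsto[OF u v lim])
  then show ?thesis
    by (simp add: l2_inner_diff_self k u v l2_inner_commute[of N k v] l2_inner_commute[of N k "u _"])
qed

text \<open>At each point the squared error is either 0 or the square of \<open>C\<close>, and
  eventually 0, so the square of \<open>C\<close> dominates it. With this, lower bounds for
  truncated kernels pass to \<open>C\<close>.\<close>

lemma L2_truncation:
  assumes C: "C \<in> L2 N" and E: "\<And>n. {x \<in> space N. E n x} \<in> sets N"
    and ev: "\<And>x. \<forall>\<^sub>F n in sequentially. E n x"
  shows "(\<lambda>x. if E n x then C x else 0) \<in> L2 N"
    and "(\<lambda>n. l2_inner N (\<lambda>x. (if E n x then C x else 0) - C x) (\<lambda>x. (if E n x then C x else 0) - C x)) \<longlonglongrightarrow> 0"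
proof -
  note [measurable] = L2_measurable[OF C]
  have meas: "(\<lambda>x. if E n x then C x else 0) \<in> borel_measurable N" for n
    by (rule measurable_If[OF _ _ E]) auto
  show "(\<lambda>x. if E n x then C x else 0) \<in> L2 N"
    by (rule L2_I[OF meas], rule Bochner_Integration.integrable_bound[OF L2_integrable_square[OF C]])
      (use meas in auto)
  have "(\<lambda>n. \<integral>x. ((if E n x then C x else 0) - C x) * ((if E n x then C x else 0) - C x) \<partial>N)
    \<longlonglongrightarrow> (\<integral>x. 0 \<partial>N)"
  proof (rule integral_dominated_convergence[where w="\<lambda>x. (C x)\<^sup>2"])
    show "AE x in N. (\<lambda>n. ((if E n x then C x else 0) - C x) * ((if E n x then C x else 0) - C x)) \<longlonglongrightarrow> 0"
    proof (rule AE_I2, rule tendsto_eventually)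
      fix x
      show "\<forall>\<^sub>F n in sequentially. ((if E n x then C x else 0) - C x) * ((if E n x then C x else 0) - C x) = 0"
        using ev[of x] by eventually_elim simp
    qed
    show "(\<lambda>x. ((if E n x then C x else 0) - C x) * ((if E n x then C x else 0) - C x)) \<in> borel_measurable N" for n
      by (intro borel_measurable_times borel_measurable_diff meas L2_measurable[OF C])
  qed (use L2_integrable_square[OF C] in \<open>auto simp: power2_eq_square\<close>)
  then show "(\<lambda>n. l2_inner N (\<lambda>x. (if E n x then C x else 0) - C x) (\<lambda>x. (if E n x then C x else 0) - C x)) \<longlonglongrightarrow> 0"
    by (simp add: l2_inner_def)
qed

text \<open>Fatou's lemma for the squares. It also supplies membership in \<open>L2\<close> for a
  limit known only to be measurable. The norm bound is asked for eventually because along a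
  subsequence it will hold only for late indices.\<close>

lemma L2_Fatou:
  assumes u: "\<And>k. u k \<in> L2 N" and v: "v \<in> borel_measurable N"
    and lim: "AE x in N. (\<lambda>k. u k x) \<longlonglongrightarrow> v x"
    and le: "\<forall>\<^sub>F k in sequentially. l2_inner N (u k) (u k) \<le> c"
  shows "v \<in> L2 N" and "l2_inner N v v \<le> c"
proof -
  have um [measurable]: "u k \<in> borel_measurable N" for k by (rule L2_measurable[OF u])
  note [measurable] = v
  have c0: "0 \<le> c"
  proof -
    obtain k where "l2_inner N (u k) (u k) \<le> c" using le eventually_happens' by force
    then show ?thesis using l2_inner_nonneg[of N "u k"] by linarith
  qed
  have int_u: "(\<integral>\<^sup>+x. ennreal ((u k x)\<^sup>2) \<partial>N) = ennreal (l2_inner N (u k) (u k))" for k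
    using nn_integral_eq_integral[OF L2_integrable_square[OF u[of k]]]
    by (simp add: l2_inner_def power2_eq_square)
  have "(\<integral>\<^sup>+x. ennreal ((v x)\<^sup>2) \<partial>N) = (\<integral>\<^sup>+x. liminf (\<lambda>k. ennreal ((u k x)\<^sup>2)) \<partial>N)"
  proof (rule nn_integral_cong_AE)
    show "AE x in N. ennreal ((v x)\<^sup>2) = liminf (\<lambda>k. ennreal ((u k x)\<^sup>2))"
      using lim
    proof eventually_elim
      case (elim x)
      then have "(\<lambda>k. ennreal ((u k x)\<^sup>2)) \<longlonglongrightarrow> ennreal ((v x)\<^sup>2)"
        by (intro tendsto_ennrealI tendsto_power)
      then show ?case by (rule lim_imp_Liminf[OF sequentially_bot, symmetric])
    qed
  qed
  also have "\<dots> \<le> liminf (\<lambda>k. \<integral>\<^sup>+x. ennreal ((u k x)\<^sup>2) \<partial>N)"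
    by (rule nn_integral_liminf) simp
  also have "\<dots> \<le> limsup (\<lambda>k. \<integral>\<^sup>+x. ennreal ((u k x)\<^sup>2) \<partial>N)"
    by (rule Liminf_le_Limsup) simp
  also have "\<dots> \<le> ennreal c"
    using le by (intro Limsup_bounded) (auto simp: int_u elim!: eventually_mono intro: ennreal_leI)
  finally have le_c: "(\<integral>\<^sup>+x. ennreal ((v x)\<^sup>2) \<partial>N) \<le> ennreal c" .
  then have fin: "(\<integral>\<^sup>+x. ennreal ((v x)\<^sup>2) \<partial>N) < \<infinity>"
    by (metis ennreal_less_top infinity_ennreal_def le_less_trans)
  have int_v: "integrable N (\<lambda>x. (v x)\<^sup>2)"
    by (rule integrableI_bounded) (use fin in simp_all)
  then show "v \<in> L2 N" by (rule L2_I[OF v])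
  show "l2_inner N v v \<le> c"
    using le_c nn_integral_eq_integral[OF int_v] c0
    by (simp add: l2_inner_def power2_eq_square)
qed

section \<open>Lipschitz kernels on compact metric measure spaces\<close>

text \<open>The union of finite nets with radii tending to 0. The class \<open>metric_space\<close>
  gives no countable base, so separability is drawn from compactness.\<close>

lemma compact_countable_dense:
  assumes "compact (UNIV :: 'a::metric_space set)"
  obtains D :: "'a::metric_space set" where "countable D" "\<And>x e. 0 < e \<Longrightarrow> \<exists>z\<in>D. dist x z < e"
proof -
  have "\<exists>F :: 'a set. finite F \<and> UNIV \<subseteq> (\<Union>x\<in>F. ball x (inverse (real (Suc n))))" for n
    using assms unfolding compact_eq_totally_bounded by simp
  then obtain F :: "nat \<Rightarrow> 'a set" where F: "\<And>n. finite (F n)"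
      "\<And>n. UNIV \<subseteq> (\<Union>x\<in>F n. ball x (inverse (real (Suc n))))"
    by metis
  have "\<exists>z\<in>\<Union>(range F). dist x z < e" if e: "0 < e" for x e
  proof -
    obtain n where n: "inverse (real (Suc n)) < e" using reals_Archimedean[OF e] by blast
    obtain z where "z \<in> F n" "dist z x < inverse (real (Suc n))"
      using F(2)[of n] by (auto simp: subset_iff)
    then show ?thesis using n by (intro bexI[of _ z]) (auto simp: dist_commute)
  qed
  moreover have "countable (\<Union>(range F))" using F(1) by (intro countable_UN) (auto simp: countable_finite)
  ultimately show thesis using that by blast
qed

text \<open>Measurability is required for the product sigma-algebra, which the type class does not
  identify with the Borel sets of the product; continuity of \<open>dist\<close> is thus not enough.
  Instead each sublevel set is a countable union, over dense points \<open>z\<close>, of sets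
  defined by the distances of both points to \<open>z\<close>.\<close>

lemma borel_measurable_dist_compact:
  fixes M :: "'a::metric_space measure"
  assumes "compact (UNIV :: 'a set)" and sets: "sets M = sets borel"
  shows "(\<lambda>(x, y). dist x y) \<in> borel_measurable (M \<Otimes>\<^sub>M M)"
proof (subst borel_measurable_iff_less, intro allI)
  fix a :: real
  obtain D :: "'a set" where D: "countable D" "\<And>x e. 0 < e \<Longrightarrow> \<exists>z\<in>D. dist x z < e"
    using compact_countable_dense[OF assms(1)] by blast
  have cont: "(\<lambda>x. dist x z) \<in> borel_measurable M" for z
    unfolding measurable_cong_sets[OF sets refl]
    by (intro borel_measurable_continuous_onI continuous_intros)
  have meas: "(\<lambda>w. dist (fst w) z + dist (snd w) z) \<in> borel_measurable (M \<Otimes>\<^sub>M M)" for z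
    using cont by measurable
  have "{w \<in> space (M \<Otimes>\<^sub>M M). (case w of (x, y) \<Rightarrow> dist x y) < a}
      = (\<Union>z\<in>D. {w \<in> space (M \<Otimes>\<^sub>M M). dist (fst w) z + dist (snd w) z < a})"
  proof (intro set_eqI iffI)
    fix w assume w: "w \<in> {w \<in> space (M \<Otimes>\<^sub>M M). (case w of (x, y) \<Rightarrow> dist x y) < a}"
    obtain x y where xy: "w = (x, y)" by (cases w)
    \<comment> \<open>The detour through \<open>z\<close> adds at most twice
      \<open>dist x z\<close>, hence half of the slack.\<close>
    obtain z where z: "z \<in> D" "dist x z < (a - dist x y) / 2"
      using D(2)[of "(a - dist x y) / 2" x] w xy by auto
    have "dist y z \<le> dist x y + dist x z" by (metis dist_commute dist_triangle)
    then have "dist x z + dist y z < a" using z(2) by (simp add: field_simps)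
    then show "w \<in> (\<Union>z\<in>D. {w \<in> space (M \<Otimes>\<^sub>M M). dist (fst w) z + dist (snd w) z < a})"
      using w xy z(1) by auto
  next
    fix w assume "w \<in> (\<Union>z\<in>D. {w \<in> space (M \<Otimes>\<^sub>M M). dist (fst w) z + dist (snd w) z < a})"
    then obtain z where "w \<in> space (M \<Otimes>\<^sub>M M)" "dist (fst w) z + dist (snd w) z < a" by blast
    then show "w \<in> {w \<in> space (M \<Otimes>\<^sub>M M). (case w of (x, y) \<Rightarrow> dist x y) < a}"
      using dist_triangle2[of "fst w" "snd w" z] by (auto simp: case_prod_beta)
  qed
  also have "\<dots> \<in> sets (M \<Otimes>\<^sub>M M)"
    by (intro sets.countable_UN' D(1) image_subsetI borel_measurable_less[OF meas] measurable_const) simp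
  finally show "{w \<in> space (M \<Otimes>\<^sub>M M). (case w of (x, y) \<Rightarrow> dist x y) < a} \<in> sets (M \<Otimes>\<^sub>M M)" .
qed

section \<open>Tensor products on product measures\<close>

definition tensor :: "('a \<Rightarrow> real) \<Rightarrow> ('b \<Rightarrow> real) \<Rightarrow> 'a \<times> 'b \<Rightarrow> real" where
  "tensor u v = (\<lambda>(x, t). u x * v t)"

lemma (in pair_sigma_finite) integrable_tensor:
  assumes u: "integrable M1 u" and v: "integrable M2 v"
  shows "integrable (M1 \<Otimes>\<^sub>M M2) (tensor u v)"
proof (rule Fubini_integrable)
  have [measurable]: "u \<in> borel_measurable M1" "v \<in> borel_measurable M2" using u v by auto
  show "tensor u v \<in> borel_measurable (M1 \<Otimes>\<^sub>M M2)" unfolding tensor_def by measurable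
  show "integrable M1 (\<lambda>x. \<integral>y. norm (tensor u v (x, y)) \<partial>M2)"
    using u by (simp add: tensor_def abs_mult)
  show "AE x in M1. integrable M2 (\<lambda>y. tensor u v (x, y))"
    using v by (simp add: tensor_def)
qed

lemma (in pair_sigma_finite) integral_tensor:
  assumes u: "integrable M1 u" and v: "integrable M2 v"
  shows "(\<integral>z. tensor u v z \<partial>(M1 \<Otimes>\<^sub>M M2)) = (\<integral>x. u x \<partial>M1) * (\<integral>y. v y \<partial>M2)"
  by (subst integral_fst'[OF integrable_tensor[OF u v], symmetric]) (simp add: tensor_def)

lemma tensor_mult_tensor: "tensor u v z * tensor u' v' z = tensor (\<lambda>x. u x * u' x) (\<lambda>t. v t * v' t) z"
  by (simp add: tensor_def split: prod.splits)

lemma (in pair_sigma_finite) tensor_L2: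
  assumes u: "u \<in> L2 M1" and v: "v \<in> L2 M2"
  shows "tensor u v \<in> L2 (M1 \<Otimes>\<^sub>M M2)"
proof (rule L2_I)
  have [measurable]: "u \<in> borel_measurable M1" "v \<in> borel_measurable M2"
    using u v by (auto dest: L2_measurable)
  show "tensor u v \<in> borel_measurable (M1 \<Otimes>\<^sub>M M2)" unfolding tensor_def by measurable
  show "integrable (M1 \<Otimes>\<^sub>M M2) (\<lambda>z. (tensor u v z)\<^sup>2)"
    unfolding power2_eq_square tensor_mult_tensor
    by (intro integrable_tensor L2_integrable_mult u v)
qed

lemma (in pair_sigma_finite) l2_inner_tensor:
  assumes "u \<in> L2 M1" "u' \<in> L2 M1" "v \<in> L2 M2" "v' \<in> L2 M2"
  shows "l2_inner (M1 \<Otimes>\<^sub>M M2) (tensor u v) (tensor u' v') = l2_inner M1 u u' * l2_inner M2 v v'"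
  using integral_tensor[OF L2_integrable_mult[OF assms(1,2)] L2_integrable_mult[OF assms(3,4)]]
  by (simp add: l2_inner_def tensor_mult_tensor)

lemma (in prob_space) L2_integrable: "f \<in> L2 M \<Longrightarrow> integrable M f"
  using L2_integrable_mult[of f M "\<lambda>_. 1"] L2_bounded[OF finite_measure_axioms, of "\<lambda>_. 1" 1] by simp

text \<open>Cauchy-Schwarz against the constant 1, which has norm 1 in a probability space.\<close>

lemma (in prob_space) L1_le_L2:
  assumes "f \<in> L2 M" shows "(\<integral>x. \<bar>f x\<bar> \<partial>M) \<le> sqrt (l2_inner M f f)"
proof -
  have "(\<lambda>_. 1) \<in> L2 M" by (rule L2_bounded[OF finite_measure_axioms, of _ 1]) auto
  moreover have "(\<lambda>x. \<bar>f x\<bar>) \<in> L2 M"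
    using assms by (intro L2_I) (auto dest: L2_measurable L2_integrable_square)
  ultimately have "(l2_inner M (\<lambda>x. \<bar>f x\<bar>) (\<lambda>_. 1))\<^sup>2 \<le> l2_inner M (\<lambda>x. \<bar>f x\<bar>) (\<lambda>x. \<bar>f x\<bar>) * l2_inner M (\<lambda>_. 1) (\<lambda>_. 1)"
    by (intro l2_inner_Cauchy_Schwarz)
  then show ?thesis
    by (intro real_le_rsqrt) (simp add: l2_inner_def prob_space)
qed

text \<open>The core of the Riesz-Fischer argument. Squared increments of order 4 to the power -n
  have integrals of order 2 to the power -n, so the sum of all increments has finite integral and is
  finite almost everywhere.\<close>

lemma (in prob_space) L2_summable_increments_AE_convergent:
  assumes u: "\<And>n. u n \<in> L2 M"
    and le: "\<And>n. l2_inner M (\<lambda>x. u (Suc n) x - u n x) (\<lambda>x. u (Suc n) x - u n x) \<le> (1/4) ^ n"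
  shows "AE x in M. convergent (\<lambda>n. u n x)"
proof -
  define d where "d n x = \<bar>u (Suc n) x - u n x\<bar>" for n x
  have diffL: "(\<lambda>x. u (Suc n) x - u n x) \<in> L2 M" for n by (intro L2_diff u)
  have d_int: "integrable M (d n)" for n
    unfolding d_def using L2_integrable[OF diffL] by simp
  note [measurable] = borel_measurable_integrable[OF d_int]
  have d_le: "(\<integral>x. d n x \<partial>M) \<le> (1/2) ^ n" for n
  proof -
    have "(\<integral>x. d n x \<partial>M) \<le> sqrt ((1/4) ^ n)"
      unfolding d_def by (rule order_trans[OF L1_le_L2[OF diffL] real_sqrt_le_mono[OF le]])
    also have "\<dots> = (1/2) ^ n" by (simp add: real_sqrt_power real_sqrt_divide)
    finally show ?thesis .
  qed
  have "summable (\<lambda>n. \<integral>x. d n x \<partial>M)"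
  proof (rule summable_comparison_test')
    show "summable (\<lambda>n. (1/2 :: real) ^ n)" by (rule summable_geometric) simp
    show "norm (\<integral>x. d n x \<partial>M) \<le> (1/2) ^ n" for n
      using d_le[of n] by (simp add: d_def)
  qed
  then have "(\<Sum>n. ennreal (\<integral>x. d n x \<partial>M)) \<noteq> top"
    by (rule ennreal_suminf_neq_top) (simp add: d_def)
  moreover have "(\<integral>\<^sup>+x. (\<Sum>n. ennreal (d n x)) \<partial>M) = (\<Sum>n. ennreal (\<integral>x. d n x \<partial>M))"
  proof -
    have "(\<integral>\<^sup>+x. ennreal (d n x) \<partial>M) = ennreal (\<integral>x. d n x \<partial>M)" for n
      by (rule nn_integral_eq_integral[OF d_int]) (simp add: d_def)
    then show ?thesis by (subst nn_integral_suminf) simp_all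
  qed
  ultimately have "AE x in M. (\<Sum>n. ennreal (d n x)) \<noteq> \<infinity>"
    by (intro nn_integral_noteq_infinite) simp_all
  then show ?thesis
  proof eventually_elim
    case (elim x)
    then have "summable (\<lambda>n. d n x)"
      by (intro summable_suminf_not_top) (simp_all add: d_def)
    then have "summable (\<lambda>n. u (Suc n) x - u n x)"
      unfolding d_def by (rule summable_rabs_cancel)
    then have "convergent (\<lambda>n. \<Sum>i<n. u (Suc i) x - u i x)"
      by (simp add: summable_iff_convergent)
    then have "convergent (\<lambda>n. u n x - u 0 x)"
      by (simp only: sum_lessThan_telescope[of "\<lambda>n. u n x"])
    then show ?case
      using convergent_add[of "\<lambda>n. u n x - u 0 x" "\<lambda>_. u 0 x"] by (simp add: convergent_const)
  qed
qed

text \<open>The estimates hold everywhere, not just almost everywhere, so images under the operator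
  are bounded Lipschitz functions defined at every point. The Lipschitz estimate is the source of
  compactness.\<close>

locale lipschitz_kernel = metric_measure_space M for M :: "'a::metric_space measure" +
  fixes K :: "'a \<Rightarrow> 'a \<Rightarrow> real" and kb lc :: real
  assumes K_meas: "(\<lambda>(x, t). K x t) \<in> borel_measurable (M \<Otimes>\<^sub>M M)"
    and K_sym: "K x t = K t x"
    and K_bound: "\<bar>K x t\<bar> \<le> kb"
    and K_lip: "\<bar>K x t - K y t\<bar> \<le> lc * dist x y"
    and lc_nonneg: "0 \<le> lc"
begin

sublocale P: pair_prob_space M M ..

abbreviation T :: "('a \<Rightarrow> real) \<Rightarrow> 'a \<Rightarrow> real" where
  "T \<equiv> integral_operator M K"

lemma space_M: "space M = UNIV"
  using sets_eq_imp_space_eq[OF sets_borel] by simp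

lemma kb_nonneg: "0 \<le> kb"
  using K_bound[of undefined undefined] by linarith

lemma K_L2: "(\<lambda>(x, t). K x t) \<in> L2 (M \<Otimes>\<^sub>M M)"
  by (rule L2_bounded[OF P.finite_measure_axioms K_meas, of kb]) (auto simp: K_bound)

lemma K_section_meas: "K x \<in> borel_measurable M"
  using measurable_compose[OF measurable_Pair1'[of x M M] K_meas] by (simp add: space_M)

lemma K_mult_integrable: "\<psi> \<in> L2 M \<Longrightarrow> integrable M (\<lambda>s. K x s * \<psi> s)"
  by (intro L2_integrable_mult L2_bounded[OF finite_measure_axioms K_section_meas K_bound])

lemma T_diff: "\<psi> \<in> L2 M \<Longrightarrow> \<xi> \<in> L2 M \<Longrightarrow> T (\<lambda>x. \<psi> x - \<xi> x) y = T \<psi> y - T \<xi> y"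
  by (simp add: integral_operator_def right_diff_distrib K_mult_integrable)

lemma T_cmult: "T (\<lambda>x. c * \<psi> x) y = c * T \<psi> y"
  by (simp add: integral_operator_def mult.left_commute[of _ c])

text \<open>One estimate for three uses: \<open>k\<close> is a section of \<open>K\<close> for
  boundedness, a difference of two sections for the Lipschitz bound, and \<open>T \<psi>\<close> for
  the quadratic form.\<close>

lemma integral_mult_bound:
  assumes \<psi>: "\<psi> \<in> L2 M" and k: "k \<in> borel_measurable M" "\<And>s. \<bar>k s\<bar> \<le> c"
  shows "\<bar>\<integral>s. k s * \<psi> s \<partial>M\<bar> \<le> c * sqrt (l2_inner M \<psi> \<psi>)"
proof -
  have c: "0 \<le> c" using k(2)[of undefined] by linarith
  have "\<bar>\<integral>s. k s * \<psi> s \<partial>M\<bar> \<le> (\<integral>s. c * \<bar>\<psi> s\<bar> \<partial>M)"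
  proof (rule order_trans)
    show "\<bar>\<integral>s. k s * \<psi> s \<partial>M\<bar> \<le> (\<integral>s. norm (k s * \<psi> s) \<partial>M)"
      using integral_norm_bound[of M "\<lambda>s. k s * \<psi> s"] by simp
    have "integrable M (\<lambda>s. k s * \<psi> s)"
      by (intro L2_integrable_mult L2_bounded[OF finite_measure_axioms k] \<psi>)
    then show "(\<integral>s. norm (k s * \<psi> s) \<partial>M) \<le> (\<integral>s. c * \<bar>\<psi> s\<bar> \<partial>M)"
      using L2_integrable[OF \<psi>] k(2)
      by (intro integral_mono integrable_norm) (auto simp: abs_mult mult_right_mono)
  qed
  also have "\<dots> \<le> c * sqrt (l2_inner M \<psi> \<psi>)"
    using mult_left_mono[OF L1_le_L2[OF \<psi>] c] by simp
  finally show ?thesis .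
qed

lemma T_bound: "\<psi> \<in> L2 M \<Longrightarrow> \<bar>T \<psi> x\<bar> \<le> kb * sqrt (l2_inner M \<psi> \<psi>)"
  unfolding integral_operator_def by (rule integral_mult_bound[OF _ K_section_meas K_bound])

lemma T_lip:
  assumes \<psi>: "\<psi> \<in> L2 M"
  shows "\<bar>T \<psi> x - T \<psi> y\<bar> \<le> lc * dist x y * sqrt (l2_inner M \<psi> \<psi>)"
proof -
  have "T \<psi> x - T \<psi> y = (\<integral>s. (K x s - K y s) * \<psi> s \<partial>M)"
    by (simp add: integral_operator_def left_diff_distrib K_mult_integrable \<psi>)
  then show ?thesis
    using integral_mult_bound[OF \<psi>, of "\<lambda>s. K x s - K y s" "lc * dist x y"]
    by (simp add: borel_measurable_diff K_section_meas K_lip)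
qed

lemma T_meas:
  assumes "\<psi> \<in> L2 M" shows "T \<psi> \<in> borel_measurable M"
proof -
  have [measurable]: "\<psi> \<in> borel_measurable M" "(\<lambda>(x, t). K x t) \<in> borel_measurable (M \<Otimes>\<^sub>M M)"
    using assms K_meas by (auto dest: L2_measurable)
  have "(\<lambda>(x, s). (case (x, s) of (x, s) \<Rightarrow> K x s) * \<psi> s) \<in> borel_measurable (M \<Otimes>\<^sub>M M)"
    by measurable
  then show ?thesis
    unfolding integral_operator_def[abs_def]
    by (intro borel_measurable_lebesgue_integral) (simp add: case_prod_beta)
qed

lemma T_L2: "\<psi> \<in> L2 M \<Longrightarrow> T \<psi> \<in> L2 M"
  by (rule L2_bounded[OF finite_measure_axioms T_meas T_bound])

text \<open>Fubini turns the pairing of \<open>K\<close> with a rank-one kernel into a value of the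
  bilinear form of \<open>T\<close>; finite-rank competitors are handled through this.\<close>

lemma l2_inner_K_tensor:
  assumes u: "u \<in> L2 M" and v: "v \<in> L2 M"
  shows "l2_inner (M \<Otimes>\<^sub>M M) (\<lambda>(x, t). K x t) (tensor u v) = l2_inner M u (T v)"
proof -
  have "l2_inner (M \<Otimes>\<^sub>M M) (\<lambda>(x, t). K x t) (tensor u v)
      = (\<integral>x. (\<integral>t. K x t * (u x * v t) \<partial>M) \<partial>M)"
    unfolding l2_inner_def
    by (subst P.integral_fst'[OF L2_integrable_mult[OF K_L2 P.tensor_L2[OF u v]], symmetric])
      (simp add: tensor_def)
  then show ?thesis
    by (simp add: l2_inner_def integral_operator_def mult.left_commute[of _ "u _"])
qed

lemma T_symmetric:
  assumes u: "u \<in> L2 M" and v: "v \<in> L2 M"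
  shows "l2_inner M (T u) v = l2_inner M u (T v)"
proof -
  have "l2_inner M u (T v) = (\<integral>z. (case z of (x, t) \<Rightarrow> K x t) * tensor u v z \<partial>(M \<Otimes>\<^sub>M M))"
    using l2_inner_K_tensor[OF u v] by (simp add: l2_inner_def)
  also have "\<dots> = (\<integral>(x, t). (case (t, x) of (x, t) \<Rightarrow> K x t) * tensor u v (t, x) \<partial>(M \<Otimes>\<^sub>M M))"
    by (subst P.integral_product_swap[symmetric])
      (auto intro: borel_measurable_times K_meas L2_measurable P.tensor_L2 u v)
  also have "\<dots> = (\<integral>z. (case z of (x, t) \<Rightarrow> K x t) * tensor v u z \<partial>(M \<Otimes>\<^sub>M M))"
    by (intro Bochner_Integration.integral_cong refl) (auto simp: tensor_def K_sym mult.commute)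
  also have "\<dots> = l2_inner M v (T u)"
    using l2_inner_K_tensor[OF v u] by (simp add: l2_inner_def)
  finally show ?thesis by (simp add: l2_inner_commute)
qed

text \<open>An Arzela-Ascoli argument: a diagonal subsequence converges on a countable dense set,
  and the common Lipschitz constant carries the Cauchy property to every point. Pointwise
  convergence is enough, since the common bound \<open>kb\<close> later upgrades it to convergence
  in L2.\<close>

lemma T_convergent_subsequence:
  assumes \<psi>: "\<And>n. \<psi> n \<in> L2 M" and norm: "\<And>n. l2_inner M (\<psi> n) (\<psi> n) \<le> 1"
  obtains r \<xi> where "strict_mono (r :: nat \<Rightarrow> nat)" "\<And>x. (\<lambda>n. T (\<psi> (r n)) x) \<longlonglongrightarrow> \<xi> x"
proof -
  obtain D :: "'a set" where D: "countable D" "\<And>x e. 0 < e \<Longrightarrow> \<exists>z\<in>D. dist x z < e"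
    using compact_countable_dense[OF compact_space] by blast
  have sq: "sqrt (l2_inner M (\<psi> n) (\<psi> n)) \<le> 1" for n using norm[of n] by simp
  have "norm (T (\<psi> n) x) \<le> kb" for n x
    using T_bound[OF \<psi>, of n x] mult_left_mono[OF sq kb_nonneg, of n] by simp
  then obtain r where r: "strict_mono (r :: nat \<Rightarrow> nat)"
    "\<And>z. z \<in> D \<Longrightarrow> \<exists>l. (\<lambda>n. T (\<psi> (r n)) z) \<longlonglongrightarrow> l"
    using function_convergent_subsequence[OF D(1), of "\<lambda>n x. T (\<psi> n) x" kb] by blast
  have lip: "\<bar>T (\<psi> n) x - T (\<psi> n) y\<bar> \<le> lc * dist x y" for n x y
    using T_lip[OF \<psi>, of n x y] mult_left_mono[OF sq, of "lc * dist x y" n] lc_nonneg by simp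
  have "convergent (\<lambda>n. T (\<psi> (r n)) x)" for x
  proof (rule Cauchy_convergent, rule metric_CauchyI)
    fix e :: real assume "0 < e"
    \<comment> \<open>\<open>lc + 1\<close> rather than \<open>lc\<close>, which may be 0.\<close>
    then have "0 < e / (3 * (lc + 1))" using lc_nonneg by simp
    then obtain z where z: "z \<in> D" "dist x z < e / (3 * (lc + 1))" using D(2) by blast
    have "lc * dist x z \<le> (lc + 1) * dist x z" by (simp add: mult_right_mono)
    also have "\<dots> < e / 3" using z(2) lc_nonneg by (simp add: field_simps)
    finally have xz: "lc * dist x z < e / 3" .
    have "Cauchy (\<lambda>n. T (\<psi> (r n)) z)" using r(2)[OF z(1)] by (auto intro: LIMSEQ_imp_Cauchy)
    then obtain N where N: "\<And>m n. N \<le> m \<Longrightarrow> N \<le> n \<Longrightarrow> dist (T (\<psi> (r m)) z) (T (\<psi> (r n)) z) < e / 3"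
      using metric_CauchyD[of "\<lambda>n. T (\<psi> (r n)) z" "e / 3"] \<open>0 < e\<close> by auto
    show "\<exists>N. \<forall>m\<ge>N. \<forall>n\<ge>N. dist (T (\<psi> (r m)) x) (T (\<psi> (r n)) x) < e"
    proof (intro exI[of _ N] allI impI)
      fix m n assume "N \<le> m" "N \<le> n"
      then show "dist (T (\<psi> (r m)) x) (T (\<psi> (r n)) x) < e"
        using N[of m n] lip[of "r m" x z] lip[of "r n" x z] xz
        unfolding dist_real_def by linarith
    qed
  qed
  then show thesis
    using r(1) that[of r "\<lambda>x. lim (\<lambda>n. T (\<psi> (r n)) x)"] by (simp add: convergent_LIMSEQ_iff)
qed

end

context lipschitz_kernel
begin

lemma T_form_bound:
  assumes \<psi>: "\<psi> \<in> L2 M"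
  shows "\<bar>l2_inner M (T \<psi>) \<psi>\<bar> \<le> kb * l2_inner M \<psi> \<psi>"
  using integral_mult_bound[OF \<psi> T_meas[OF \<psi>] T_bound[OF \<psi>]] l2_inner_nonneg[of M \<psi>]
  by (simp add: l2_inner_def mult.assoc)

lemma T_form_diff:
  assumes u: "u \<in> L2 M" and v: "v \<in> L2 M"
  shows "l2_inner M (T (\<lambda>x. u x - v x)) (\<lambda>x. u x - v x)
    = l2_inner M (T u) u - 2 * l2_inner M (T u) v + l2_inner M (T v) v"
proof -
  have "T (\<lambda>x. u x - v x) = (\<lambda>x. T u x - T v x)" using T_diff[OF u v] by auto
  then show ?thesis
    using T_symmetric[OF u v]
    by (simp add: l2_inner_diff_left l2_inner_diff_right L2_diff T_L2 u v l2_inner_commute[of M "T v" u])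
qed

end

section \<open>Positive eigenvalues\<close>

locale lipschitz_kernel_eigenpairs = lipschitz_kernel M K kb lc
  for M :: "'a::metric_space measure" and K kb lc +
  fixes lam :: "nat \<Rightarrow> real" and phi :: "nat \<Rightarrow> 'a \<Rightarrow> real"
  assumes eigenpairs: "lists_positive_eigenpairs M K lam phi"
begin

definition L :: "nat \<Rightarrow> real" where "L i = max (lam i) 0"

text \<open>Entries of \<open>phi\<close> at nonpositive \<open>lam i\<close> are unconstrained and
  need not even be measurable. Replacing them by 0 makes all \<open>ph i\<close> members of
  \<open>L2\<close>, at the price that some have norm 0.\<close>

definition ph :: "nat \<Rightarrow> 'a \<Rightarrow> real" where
  "ph i = (if 0 < lam i then phi i else (\<lambda>_. 0))"

lemma decseq_lam: "decseq lam"
  using eigenpairs by (simp add: lists_positive_eigenpairs_def)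

lemma decseq_L: "decseq L"
  unfolding decseq_def L_def using decseqD[OF decseq_lam] by (intro allI impI max.mono) auto

lemma L_nonneg: "0 \<le> L i"
  by (simp add: L_def)

lemma phi_eigenfunction: "0 < lam i \<Longrightarrow> is_eigenfunction M K (lam i) (phi i)"
  using eigenpairs by (simp add: lists_positive_eigenpairs_def)

lemma eigenfunction_in_span:
  "0 < r \<Longrightarrow> is_eigenfunction M K r \<psi> \<Longrightarrow> \<exists>c. AE x in M. \<psi> x = (\<Sum>i | lam i = r. c i * phi i x)"
  using eigenpairs by (simp add: lists_positive_eigenpairs_def)

lemma ph_L2: "ph i \<in> L2 M"
  using phi_eigenfunction[of i] by (simp add: ph_def is_eigenfunction_def L2_zero)

lemma ph_orthonormal:
  "l2_inner M (ph i) (ph j) = (if i = j \<and> 0 < lam i then 1 else 0)"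
  using eigenpairs by (auto simp: lists_positive_eigenpairs_def l2_inner_def ph_def)

lemma l2_inner_ph_eq_0: "\<not> 0 < lam i \<Longrightarrow> l2_inner M f (ph i) = 0"
  by (simp add: ph_def l2_inner_def)

lemma T_ph: "AE x in M. T (ph i) x = L i * ph i x"
  using phi_eigenfunction[of i]
  by (cases "0 < lam i") (simp_all add: ph_def L_def is_eigenfunction_def integral_operator_def)

lemma l2_inner_T_ph:
  assumes v: "v \<in> L2 M" shows "l2_inner M (ph i) (T v) = L i * l2_inner M (ph i) v"
proof -
  have "l2_inner M (ph i) (T v) = l2_inner M (T (ph i)) v" by (simp add: T_symmetric ph_L2 v)
  also have "\<dots> = l2_inner M (\<lambda>x. L i * ph i x) v"
    by (intro l2_inner_cong_AE T_L2 L2_cmult ph_L2 v T_ph)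
  finally show ?thesis by (simp add: l2_inner_cmult_left)
qed

text \<open>A maximizing sequence for the Rayleigh quotient on the orthogonal complement of the first
  eigenfunctions has a convergent image under \<open>T\<close>; its limit would be an eigenfunction that the
  list misses.\<close>

lemma Rayleigh_bound_orthogonal:
  assumes \<psi>0: "\<psi>0 \<in> L2 M" and orth0: "\<And>i. i < n \<Longrightarrow> l2_inner M \<psi>0 (ph i) = 0"
  shows "l2_inner M (T \<psi>0) \<psi>0 \<le> L n * l2_inner M \<psi>0 \<psi>0"
proof (rule ccontr)
  assume "\<not> ?thesis"
  then have gt: "L n * l2_inner M \<psi>0 \<psi>0 < l2_inner M (T \<psi>0) \<psi>0" by simp
  \<comment> \<open>\<open>r\<close> is the supremum of the Rayleigh quotient on \<open>V\<close>,
    with \<open>U\<close> the unit vectors of \<open>V\<close>. The failure of the claim at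
    \<open>\<psi>0\<close> forces \<open>r\<close> above \<open>L n\<close>.\<close>
  define V where "V = {\<psi> \<in> L2 M. \<forall>i<n. l2_inner M \<psi> (ph i) = 0}"
  define U where "U = {\<psi> \<in> V. l2_inner M \<psi> \<psi> = 1}"
  define r where "r = (SUP \<psi>\<in>U. l2_inner M (T \<psi>) \<psi>)"
  have VL2: "\<psi> \<in> L2 M" if "\<psi> \<in> V" for \<psi> using that by (simp add: V_def)
  have V_diff: "(\<lambda>x. u x - v x) \<in> V" if "u \<in> V" "v \<in> V" for u v
    using that by (simp add: V_def L2_diff l2_inner_diff_left ph_L2)
  have V_cmult: "(\<lambda>x. c * u x) \<in> V" if "u \<in> V" for u c
    using that by (simp add: V_def L2_cmult l2_inner_cmult_left)
  have V_T: "T u \<in> V" if "u \<in> V" for u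
    using that l2_inner_T_ph[of u]
    by (simp add: V_def T_L2 l2_inner_commute[of M _ "ph _"])
  have bdd: "bdd_above ((\<lambda>\<psi>. l2_inner M (T \<psi>) \<psi>) ` U)"
  proof (rule bdd_aboveI2)
    fix \<psi> assume "\<psi> \<in> U"
    then show "l2_inner M (T \<psi>) \<psi> \<le> kb"
      using T_form_bound[of \<psi>] by (simp add: U_def V_def)
  qed
  have normalize: "\<exists>c. (\<lambda>x. c * u x) \<in> U \<and> l2_inner M (T (\<lambda>x. c * u x)) (\<lambda>x. c * u x)
      = l2_inner M (T u) u / l2_inner M u u" if "u \<in> V" "0 < l2_inner M u u" for u
  proof -
    define c where "c = 1 / sqrt (l2_inner M u u)"
    then have c: "c * c = 1 / l2_inner M u u" using that(2) by simp
    have scale: "l2_inner M (\<lambda>x. c * f x) (\<lambda>x. c * u x) = l2_inner M f u / l2_inner M u u" for f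
    proof -
      have "l2_inner M (\<lambda>x. c * f x) (\<lambda>x. c * u x) = (c * c) * l2_inner M f u"
        by (simp add: l2_inner_cmult_left l2_inner_cmult_right)
      then show ?thesis by (simp add: c)
    qed
    have "T (\<lambda>x. c * u x) = (\<lambda>x. c * T u x)" using T_cmult by blast
    then show ?thesis
      using V_cmult[OF that(1), of c] that(2) scale[of u] scale[of "T u"]
      by (intro exI[of _ c]) (simp add: U_def)
  qed
  have q_le: "l2_inner M (T u) u \<le> r * l2_inner M u u" if u: "u \<in> V" for u
  proof (cases "l2_inner M u u = 0")
    case True
    then show ?thesis using T_form_bound[OF VL2[OF u]] by simp
  next
    case False
    then have pos: "0 < l2_inner M u u" using l2_inner_nonneg[of M u] by simp
    obtain c where "(\<lambda>x. c * u x) \<in> U" "l2_inner M (T (\<lambda>x. c * u x)) (\<lambda>x. c * u x)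
      = l2_inner M (T u) u / l2_inner M u u" using normalize[OF u pos] by blast
    then have "l2_inner M (T u) u / l2_inner M u u \<le> r"
      unfolding r_def using cSUP_upper[OF _ bdd] by metis
    then show ?thesis using pos by (simp add: field_simps)
  qed
  have \<psi>0V: "\<psi>0 \<in> V" using \<psi>0 orth0 by (simp add: V_def)
  have pos0: "0 < l2_inner M \<psi>0 \<psi>0"
  proof (rule ccontr)
    assume "\<not> ?thesis"
    then have "l2_inner M \<psi>0 \<psi>0 = 0" using l2_inner_nonneg[of M \<psi>0] by simp
    then show False using gt T_form_bound[OF \<psi>0] by simp
  qed
  have "L n * l2_inner M \<psi>0 \<psi>0 < r * l2_inner M \<psi>0 \<psi>0"
    using gt q_le[OF \<psi>0V] by linarith
  then have r_gt: "L n < r" using pos0 by simp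
  then have r_pos: "0 < r" using L_nonneg[of n] by linarith
  have U_ne: "U \<noteq> {}" using normalize[OF \<psi>0V pos0] by blast
  have "\<exists>\<psi>\<in>U. r - inverse (Suc k) < l2_inner M (T \<psi>) \<psi>" for k
    using less_cSUP_iff[OF U_ne bdd, of "r - inverse (Suc k)"] by (simp add: r_def)
  then obtain \<psi> where \<psi>U: "\<And>k. \<psi> k \<in> U"
    and \<psi>r: "\<And>k. r - inverse (Suc k) < l2_inner M (T (\<psi> k)) (\<psi> k)" by metis
  \<comment> \<open>\<open>A\<close> is the operator \<open>r - T\<close> and \<open>Q\<close> its
    quadratic form, which is nonnegative on \<open>V\<close> because \<open>r\<close> is the
    supremum.\<close>
  define A where "A u x = r * u x - T u x" for u x
  define Q where "Q u = r * l2_inner M u u - l2_inner M (T u) u" for u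
  have AV: "A u \<in> V" if "u \<in> V" for u
    unfolding A_def[abs_def] by (intro V_diff V_cmult V_T that)
  \<comment> \<open>A nonnegative form controls its operator, so almost-maximizers are almost
    eigenfunctions. The estimate comes from evaluating \<open>Q\<close> at
    \<open>u - s * A u\<close>, a step along the gradient; \<open>s\<close> is the reciprocal of the
    bound \<open>r + kb\<close> on the form.\<close>
  have A_bound: "l2_inner M (A u) (A u) \<le> (r + kb) * Q u" if u: "u \<in> V" for u
  proof -
    define s where "s = 1 / (r + kb)"
    have rk: "0 < r + kb" using r_pos kb_nonneg by simp
    then have s: "0 < s" "s * (r + kb) = 1" by (simp_all add: s_def)
    note uL = VL2[OF u] and AL = VL2[OF AV[OF u]]
    have "0 \<le> Q (\<lambda>x. u x - s * A u x)"
      using q_le[OF V_diff[OF u V_cmult[OF AV[OF u]]]] by (simp add: Q_def)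
    also have "Q (\<lambda>x. u x - s * A u x)
        = Q u - 2 * s * (r * l2_inner M u (A u) - l2_inner M (T u) (A u)) + s * s * Q (A u)"
    proof -
      have "T (\<lambda>x. s * A u x) = (\<lambda>x. s * T (A u) x)" using T_cmult by blast
      then show ?thesis
        unfolding Q_def
        by (simp add: T_form_diff uL AL L2_cmult l2_inner_diff_self l2_inner_cmult_left
            l2_inner_cmult_right algebra_simps)
    qed
    also have "r * l2_inner M u (A u) - l2_inner M (T u) (A u) = l2_inner M (A u) (A u)"
    proof -
      have "l2_inner M (A u) (A u) = l2_inner M (\<lambda>x. r * u x - T u x) (A u)"
        by (simp add: A_def[abs_def])
      then show ?thesis by (simp add: l2_inner_diff_left l2_inner_cmult_left L2_cmult T_L2 uL AL)
    qed
    finally have "2 * s * l2_inner M (A u) (A u) \<le> Q u + s * s * Q (A u)" by simp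
    also have "s * s * Q (A u) \<le> s * s * ((r + kb) * l2_inner M (A u) (A u))"
      using T_form_bound[OF AL] s(1)
      by (intro mult_left_mono) (auto simp: Q_def distrib_right abs_le_iff)
    also have "\<dots> = s * l2_inner M (A u) (A u)" using s(2) by (simp add: mult.assoc[symmetric])
    finally have "s * l2_inner M (A u) (A u) \<le> Q u" by simp
    then show ?thesis using rk by (simp add: s_def field_simps)
  qed
  have \<psi>V: "\<psi> k \<in> V" and \<psi>1: "l2_inner M (\<psi> k) (\<psi> k) = 1" for k
    using \<psi>U[of k] by (auto simp: U_def)
  have A_lim: "(\<lambda>k. l2_inner M (A (\<psi> k)) (A (\<psi> k))) \<longlonglongrightarrow> 0"
  proof (rule tendsto_sandwich[OF _ _ tendsto_const])
    have "l2_inner M (A (\<psi> k)) (A (\<psi> k)) \<le> (r + kb) * inverse (real (Suc k))" for k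
    proof -
      have "Q (\<psi> k) \<le> inverse (real (Suc k))" using \<psi>r[of k] by (simp add: Q_def \<psi>1)
      then have "(r + kb) * Q (\<psi> k) \<le> (r + kb) * inverse (real (Suc k))"
        using r_pos kb_nonneg by (intro mult_left_mono) auto
      then show ?thesis using A_bound[OF \<psi>V, of k] by linarith
    qed
    then show "\<forall>\<^sub>F k in sequentially. l2_inner M (A (\<psi> k)) (A (\<psi> k)) \<le> (r + kb) * inverse (real (Suc k))"
      by simp
    show "(\<lambda>k. (r + kb) * inverse (real (Suc k))) \<longlonglongrightarrow> 0"
      using tendsto_mult_right_zero[OF LIMSEQ_inverse_real_of_nat] by simp
  qed (simp add: l2_inner_nonneg)
  obtain q \<xi> where q: "strict_mono (q :: nat \<Rightarrow> nat)" "\<And>x. (\<lambda>k. T (\<psi> (q k)) x) \<longlonglongrightarrow> \<xi> x"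
    using T_convergent_subsequence[of \<psi>] VL2[OF \<psi>V] \<psi>1 by (metis order_refl)
  define u where "u k = \<psi> (q k)" for k
  have uV: "u k \<in> V" and u1: "l2_inner M (u k) (u k) = 1" for k
    by (simp_all add: u_def \<psi>V \<psi>1)
  note uL = VL2[OF uV]
  have Tu_lim: "(\<lambda>k. T (u k) x) \<longlonglongrightarrow> \<xi> x" for x using q(2) by (simp add: u_def)
  have Tu_bound: "\<bar>T (u k) x\<bar> \<le> kb" for k x using T_bound[OF uL, of k x] by (simp add: u1)
  have \<xi>_meas: "\<xi> \<in> borel_measurable M"
    by (rule borel_measurable_LIMSEQ_real[OF Tu_lim]) (rule T_meas[OF uL])
  have "\<bar>\<xi> x\<bar> \<le> kb" for x
    by (rule LIMSEQ_le_const2[OF tendsto_rabs[OF Tu_lim]]) (use Tu_bound in auto)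
  then have \<xi>L: "\<xi> \<in> L2 M" by (rule L2_bounded[OF finite_measure_axioms \<xi>_meas])
  have T_lim: "(\<lambda>k. l2_inner M (\<lambda>x. T (u k) x - \<xi> x) (\<lambda>x. T (u k) x - \<xi> x)) \<longlonglongrightarrow> 0"
    by (rule L2_dominated_convergence[OF finite_measure_axioms T_meas[OF uL] \<xi>_meas Tu_bound Tu_lim])
  \<comment> \<open>\<open>r * u k\<close> is the sum of \<open>A (u k)\<close>, which tends to 0 in
    L2, and \<open>T (u k)\<close>, which tends to \<open>\<xi>\<close>. Hence the sequence itself
    tends to \<open>\<xi>\<close> divided by \<open>r\<close>.\<close>
  define \<eta> where "\<eta> x = inverse r * \<xi> x" for x
  have \<eta>L: "\<eta> \<in> L2 M" unfolding \<eta>_def[abs_def] by (rule L2_cmult[OF \<xi>L])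
  have u_lim: "(\<lambda>k. l2_inner M (\<lambda>x. u k x - \<eta> x) (\<lambda>x. u k x - \<eta> x)) \<longlonglongrightarrow> 0"
  proof (rule tendsto_sandwich[OF _ _ tendsto_const])
    define b where "b k = inverse r * inverse r * (2 * l2_inner M (A (u k)) (A (u k))
        + 2 * l2_inner M (\<lambda>x. T (u k) x - \<xi> x) (\<lambda>x. T (u k) x - \<xi> x))" for k
    have "l2_inner M (\<lambda>x. u k x - \<eta> x) (\<lambda>x. u k x - \<eta> x) \<le> b k" for k
    proof -
      have *: "(\<lambda>x. u k x - \<eta> x) = (\<lambda>x. inverse r * (A (u k) x + (T (u k) x - \<xi> x)))"
        using r_pos by (auto simp: A_def \<eta>_def field_simps)
      have "l2_inner M (\<lambda>x. A (u k) x + (T (u k) x - \<xi> x)) (\<lambda>x. A (u k) x + (T (u k) x - \<xi> x))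
          \<le> 2 * l2_inner M (A (u k)) (A (u k))
        + 2 * l2_inner M (\<lambda>x. T (u k) x - \<xi> x) (\<lambda>x. T (u k) x - \<xi> x)"
        by (rule l2_inner_add_self_le[OF VL2[OF AV[OF uV]] L2_diff[OF T_L2[OF uL] \<xi>L]])
      then show ?thesis
        unfolding * b_def using r_pos
        by (simp add: l2_inner_cmult_left l2_inner_cmult_right mult.assoc)
    qed
    then show "\<forall>\<^sub>F k in sequentially. l2_inner M (\<lambda>x. u k x - \<eta> x) (\<lambda>x. u k x - \<eta> x) \<le> b k"
      by simp
    have "(\<lambda>k. l2_inner M (A (u k)) (A (u k))) \<longlonglongrightarrow> 0"
      using LIMSEQ_subseq_LIMSEQ[OF A_lim q(1)] by (simp add: u_def comp_def)
    then have "b \<longlonglongrightarrow> inverse r * inverse r * (2 * 0 + 2 * 0)"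
      unfolding b_def by (intro tendsto_intros T_lim)
    then show "b \<longlonglongrightarrow> 0" by simp
  qed (simp add: l2_inner_nonneg)
  have T\<eta>: "T \<eta> x = r * \<eta> x" for x
  proof -
    have "(\<lambda>k. T (u k) x - T \<eta> x) \<longlonglongrightarrow> 0"
    proof (rule Lim_null_comparison)
      show "\<forall>\<^sub>F k in sequentially. norm (T (u k) x - T \<eta> x)
          \<le> kb * sqrt (l2_inner M (\<lambda>x. u k x - \<eta> x) (\<lambda>x. u k x - \<eta> x))"
        using T_bound[OF L2_diff[OF uL \<eta>L]] by (simp add: T_diff uL \<eta>L)
      show "(\<lambda>k. kb * sqrt (l2_inner M (\<lambda>x. u k x - \<eta> x) (\<lambda>x. u k x - \<eta> x))) \<longlonglongrightarrow> 0"
        using tendsto_mult_right_zero[OF tendsto_real_sqrt[OF u_lim, simplified]] by simp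
    qed
    then have "(\<lambda>k. T (u k) x) \<longlonglongrightarrow> T \<eta> x" by (rule LIM_zero_cancel)
    then have "T \<eta> x = \<xi> x" using LIMSEQ_unique Tu_lim by blast
    then show ?thesis using r_pos by (simp add: \<eta>_def)
  qed
  have \<eta>1: "l2_inner M \<eta> \<eta> = 1"
    using l2_inner_self_tendsto[OF uL \<eta>L u_lim] by (simp add: u1 LIMSEQ_const_iff)
  have \<eta>orth: "l2_inner M \<eta> (ph i) = 0" if "i < n" for i
  proof -
    have "l2_inner M (u k) (ph i) = 0" for k using uV[of k] that by (simp add: V_def)
    then show ?thesis
      using l2_inner_tendsto_left[OF uL \<eta>L ph_L2[of i] u_lim] by (simp add: LIMSEQ_const_iff)
  qed
  have "\<not> (AE x in M. \<eta> x = 0)"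
  proof
    assume "AE x in M. \<eta> x = 0"
    then have "l2_inner M \<eta> \<eta> = l2_inner M (\<lambda>_. 0) \<eta>"
      by (intro l2_inner_cong_AE \<eta>L L2_zero)
    then show False using \<eta>1 by (simp add: l2_inner_def)
  qed
  then have "is_eigenfunction M K r \<eta>"
    using \<eta>L T\<eta> by (simp add: is_eigenfunction_def)
  then obtain c where c: "AE x in M. \<eta> x = (\<Sum>i | lam i = r. c i * phi i x)"
    using eigenfunction_in_span[OF r_pos] by blast
  \<comment> \<open>As \<open>r\<close> exceeds \<open>L n\<close> and \<open>lam\<close> decreases,
    every listed eigenfunction for \<open>r\<close> has index below \<open>n\<close>. So
    \<open>\<eta>\<close> lies in the span of functions to which it is orthogonal.\<close>
  have idx: "i < n" "phi i = ph i" if "lam i = r" for i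
  proof -
    show "i < n"
    proof (rule ccontr)
      assume "\<not> i < n"
      then have "lam i \<le> lam n" using decseq_lam by (simp add: decseqD)
      then show False using r_gt that by (simp add: L_def)
    qed
    show "phi i = ph i" using that r_pos by (simp add: ph_def)
  qed
  have "(\<Sum>i | lam i = r. c i * phi i x) = (\<Sum>i | lam i = r. c i * ph i x)" for x
    by (intro sum.cong refl) (simp add: idx(2))
  with c have "l2_inner M \<eta> \<eta> = l2_inner M (\<lambda>x. \<Sum>i | lam i = r. c i * ph i x) \<eta>"
    by (intro l2_inner_cong_AE \<eta>L L2_sum L2_cmult ph_L2) simp
  also have "\<dots> = (\<Sum>i | lam i = r. c i * l2_inner M (ph i) \<eta>)"
    by (simp add: l2_inner_sum_left L2_cmult ph_L2 \<eta>L l2_inner_cmult_left)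
  also have "\<dots> = 0"
    by (intro sum.neutral) (auto simp: l2_inner_commute[of M _ \<eta>] \<eta>orth idx(1))
  finally show False using \<eta>1 by simp
qed

text \<open>The family is orthonormal only where \<open>lam\<close> is positive; at the other
  indices \<open>ph j\<close> is 0 and both sides vanish.\<close>

lemma l2_inner_ph_proj:
  assumes "j < n" and "\<psi> \<in> L2 M"
  shows "l2_inner M (ph j) (\<lambda>x. \<Sum>i<n. l2_inner M \<psi> (ph i) * ph i x) = l2_inner M \<psi> (ph j)"
proof -
  have "l2_inner M (ph j) (\<lambda>x. \<Sum>i<n. l2_inner M \<psi> (ph i) * ph i x)
      = (\<Sum>i<n. l2_inner M \<psi> (ph i) * l2_inner M (ph j) (ph i))"
    by (simp add: l2_inner_sum_right L2_cmult ph_L2 l2_inner_cmult_right)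
  also have "\<dots> = (\<Sum>i<n. if i = j then l2_inner M \<psi> (ph j) else 0)"
    by (intro sum.cong refl) (auto simp: ph_orthonormal l2_inner_ph_eq_0)
  finally show ?thesis using assms by simp
qed

text \<open>Let \<open>s\<close> be the projection of \<open>\<psi>\<close> to the first
  \<open>n\<close> eigenfunctions. Their span is invariant under \<open>T\<close>, so the cross term
  equals the form at \<open>s\<close> and the form splits. The part at \<open>s\<close> is the sum;
  the remainder is orthogonal to these eigenfunctions and no longer than
  \<open>\<psi>\<close>.\<close>

lemma quadratic_form_bound:
  assumes \<psi>: "\<psi> \<in> L2 M"
  shows "l2_inner M (T \<psi>) \<psi> \<le> (\<Sum>i<n. L i * (l2_inner M \<psi> (ph i))\<^sup>2) + L n * l2_inner M \<psi> \<psi>"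
proof -
  define a where "a i = l2_inner M \<psi> (ph i)" for i
  define s where "s x = (\<Sum>i<n. a i * ph i x)" for x
  have sL: "s \<in> L2 M" unfolding s_def[abs_def] by (intro L2_sum L2_cmult ph_L2)
  have ph_s: "l2_inner M (ph j) s = a j" if "j < n" for j
    using l2_inner_ph_proj[OF that \<psi>] by (simp add: s_def[abs_def] a_def)
  have s_inner: "l2_inner M s v = (\<Sum>i<n. a i * l2_inner M (ph i) v)" if "v \<in> L2 M" for v
    unfolding s_def by (simp add: l2_inner_sum_left L2_cmult ph_L2 that l2_inner_cmult_left)
  have Ts: "l2_inner M (T s) v = (\<Sum>i<n. a i * (L i * l2_inner M (ph i) v))" if "v \<in> L2 M" for v
    by (simp add: T_symmetric sL that s_inner T_L2 l2_inner_T_ph)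
  have "l2_inner M (T \<psi>) s = l2_inner M (T s) \<psi>"
    by (simp add: T_symmetric \<psi> sL l2_inner_commute[of M \<psi>])
  also have "\<dots> = (\<Sum>i<n. L i * (a i)\<^sup>2)"
    using Ts[OF \<psi>] by (simp add: a_def l2_inner_commute[of M "ph _" \<psi>] power2_eq_square ac_simps)
  finally have 1: "l2_inner M (T \<psi>) s = (\<Sum>i<n. L i * (a i)\<^sup>2)" .
  have 2: "l2_inner M (T s) s = (\<Sum>i<n. L i * (a i)\<^sup>2)"
    by (simp add: Ts sL ph_s power2_eq_square ac_simps)
  have 3: "l2_inner M \<psi> s = (\<Sum>i<n. (a i)\<^sup>2)"
    using s_inner[OF \<psi>]
    by (simp add: a_def l2_inner_commute[of M "ph _" \<psi>] l2_inner_commute[of M s \<psi>] power2_eq_square)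
  have 4: "l2_inner M s s = (\<Sum>i<n. (a i)\<^sup>2)"
    by (simp add: s_inner sL ph_s power2_eq_square)
  have "l2_inner M (T (\<lambda>x. \<psi> x - s x)) (\<lambda>x. \<psi> x - s x)
      \<le> L n * l2_inner M (\<lambda>x. \<psi> x - s x) (\<lambda>x. \<psi> x - s x)"
    using ph_s
    by (intro Rayleigh_bound_orthogonal L2_diff \<psi> sL)
      (simp add: l2_inner_diff_left \<psi> sL ph_L2 l2_inner_commute[of M s] a_def)
  also have "\<dots> \<le> L n * l2_inner M \<psi> \<psi>"
    by (intro mult_left_mono L_nonneg) (simp add: l2_inner_diff_self \<psi> sL 3 4 sum_nonneg)
  finally show ?thesis by (simp add: T_form_diff \<psi> sL 1 2 a_def)
qed

end

section \<open>Lower bounds for the strain\<close>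

context lipschitz_kernel
begin

section \<open>Finite-rank kernels as elements of L2 of the product\<close>

definition rank_kernel :: "nat \<Rightarrow> (nat \<Rightarrow> 'a \<Rightarrow> real) \<Rightarrow> 'a \<times> 'a \<Rightarrow> real" where
  "rank_kernel p h = (\<lambda>z. \<Sum>k<p. tensor (h k) (h k) z)"

abbreviation Kp :: "'a \<times> 'a \<Rightarrow> real" where "Kp \<equiv> (\<lambda>(x, t). K x t)"

lemma rank_kernel_L2: "(\<And>k. k < p \<Longrightarrow> h k \<in> L2 M) \<Longrightarrow> rank_kernel p h \<in> L2 (M \<Otimes>\<^sub>M M)"
  unfolding rank_kernel_def by (intro L2_sum P.tensor_L2) auto

lemma l2_inner_rank_kernel:
  assumes "\<And>k. k < p \<Longrightarrow> h k \<in> L2 M" and "\<And>l. l < q \<Longrightarrow> g l \<in> L2 M"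
  shows "l2_inner (M \<Otimes>\<^sub>M M) (rank_kernel p h) (rank_kernel q g)
    = (\<Sum>k<p. \<Sum>l<q. (l2_inner M (h k) (g l))\<^sup>2)"
proof -
  have "l2_inner (M \<Otimes>\<^sub>M M) (rank_kernel p h) (rank_kernel q g)
      = (\<Sum>k<p. l2_inner (M \<Otimes>\<^sub>M M) (tensor (h k) (h k)) (rank_kernel q g))"
    unfolding rank_kernel_def[of p] using assms
    by (intro l2_inner_sum_left P.tensor_L2 rank_kernel_L2) auto
  also have "\<dots> = (\<Sum>k<p. \<Sum>l<q. l2_inner (M \<Otimes>\<^sub>M M) (tensor (h k) (h k)) (tensor (g l) (g l)))"
    unfolding rank_kernel_def using assms
    by (intro sum.cong refl l2_inner_sum_right P.tensor_L2) auto
  also have "\<dots> = (\<Sum>k<p. \<Sum>l<q. (l2_inner M (h k) (g l))\<^sup>2)"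
    using assms by (intro sum.cong refl) (simp add: P.l2_inner_tensor power2_eq_square)
  finally show ?thesis .
qed

lemma l2_inner_K_rank_kernel:
  assumes "\<And>k. k < p \<Longrightarrow> h k \<in> L2 M"
  shows "l2_inner (M \<Otimes>\<^sub>M M) Kp (rank_kernel p h) = (\<Sum>k<p. l2_inner M (T (h k)) (h k))"
proof -
  have "l2_inner (M \<Otimes>\<^sub>M M) Kp (rank_kernel p h)
      = (\<Sum>k<p. l2_inner (M \<Otimes>\<^sub>M M) Kp (tensor (h k) (h k)))"
    unfolding rank_kernel_def using assms
    by (intro l2_inner_sum_right P.tensor_L2 K_L2) auto
  also have "\<dots> = (\<Sum>k<p. l2_inner M (T (h k)) (h k))"
    using assms by (intro sum.cong refl) (simp add: l2_inner_K_tensor l2_inner_commute[of M "T _"])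
  finally show ?thesis .
qed

end

context lipschitz_kernel_eigenpairs
begin

text \<open>Agrees pointwise with \<open>mds_coord lam phi\<close>, since the factor vanishes
  wherever \<open>ph i\<close> and \<open>phi i\<close> may differ; built from \<open>ph\<close>, it
  lies in \<open>L2\<close> for every index.\<close>

definition mc :: "nat \<Rightarrow> 'a \<Rightarrow> real" where
  "mc i x = sqrt (L i) * ph i x"

lemma mds_coord_eq_mc: "mds_coord lam phi i x = mc i x"
  by (simp add: mds_coord_def mc_def L_def ph_def)

lemma mc_L2: "mc i \<in> L2 M"
  unfolding mc_def[abs_def] by (intro L2_cmult ph_L2)

lemma mc_orthogonal: "l2_inner M (mc i) (mc j) = (if i = j then L i else 0)"
  unfolding mc_def
  by (auto simp: l2_inner_cmult_left l2_inner_cmult_right ph_orthonormal L_nonneg mult.assoc[symmetric] L_def)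

lemma T_mc: "l2_inner M (T (mc i)) (mc i) = (L i)\<^sup>2"
proof -
  have mc: "l2_inner M (mc i) f = sqrt (L i) * l2_inner M (ph i) f" for f
    by (simp add: mc_def[abs_def] l2_inner_cmult_left)
  have "l2_inner M (T (mc i)) (mc i) = l2_inner M (mc i) (T (mc i))"
    by (rule l2_inner_commute)
  also have "\<dots> = L i * l2_inner M (mc i) (mc i)"
    by (simp add: mc l2_inner_T_ph mc_L2)
  finally show ?thesis by (simp add: mc_orthogonal power2_eq_square)
qed

lemma l2_inner_mc_kernel:
  assumes "n \<le> m"
  shows "l2_inner (M \<Otimes>\<^sub>M M) (rank_kernel n mc) (rank_kernel m mc) = (\<Sum>i<n. (L i)\<^sup>2)"
proof -
  have "(\<Sum>j<m. (l2_inner M (mc i) (mc j))\<^sup>2) = (L i)\<^sup>2" if "i < n" for i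
  proof -
    have "(\<Sum>j<m. (l2_inner M (mc i) (mc j))\<^sup>2) = (\<Sum>j<m. if i = j then (L i)\<^sup>2 else 0)"
      by (intro sum.cong refl) (simp add: mc_orthogonal)
    then show ?thesis using that assms by simp
  qed
  then show ?thesis by (simp add: l2_inner_rank_kernel mc_L2)
qed

text \<open>For this kernel the pairing with \<open>K\<close> and the squared norm are both the sum
  of the squares of the \<open>L i\<close>, so the gain is exactly that sum.\<close>

lemma dist_K_mc_kernel:
  "l2_inner (M \<Otimes>\<^sub>M M) (\<lambda>z. Kp z - rank_kernel n mc z) (\<lambda>z. Kp z - rank_kernel n mc z)
    = l2_inner (M \<Otimes>\<^sub>M M) Kp Kp - (\<Sum>i<n. (L i)\<^sup>2)"
proof -
  have "l2_inner (M \<Otimes>\<^sub>M M) Kp (rank_kernel n mc) = (\<Sum>i<n. (L i)\<^sup>2)"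
    by (simp add: l2_inner_K_rank_kernel mc_L2 T_mc)
  then show ?thesis
    using l2_inner_diff_self[OF K_L2 rank_kernel_L2, of n mc]
    by (simp add: mc_L2 l2_inner_mc_kernel)
qed

text \<open>Nonnegativity of the distance just computed. This is the Hilbert-Schmidt bound for the
  positive eigenvalues, which makes their squares summable.\<close>

lemma sum_L_squares_le: "(\<Sum>i<n. (L i)\<^sup>2) \<le> l2_inner (M \<Otimes>\<^sub>M M) Kp Kp"
  using l2_inner_nonneg[of "M \<Otimes>\<^sub>M M" "\<lambda>z. Kp z - rank_kernel n mc z"] dist_K_mc_kernel[of n]
  by simp

lemma summable_L_squares: "summable (\<lambda>i. (L i)\<^sup>2)"
  by (rule summableI_nonneg_bounded[OF _ sum_L_squares_le]) simp

lemma L_tendsto_0: "L \<longlonglongrightarrow> 0"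
  using tendsto_real_sqrt[OF summable_LIMSEQ_zero[OF summable_L_squares]] L_nonneg by simp

text \<open>Single Gram entries may grow under projection; only the sum of their squares cannot.
  With \<open>g k\<close> the projection of \<open>h k\<close>, the pairing of the two rank kernels
  equals the squared norm of the projected one, so the difference of the squared norms is a squared
  distance.\<close>

lemma sum_l2_inner_squares_ge_proj:
  fixes h :: "nat \<Rightarrow> 'a \<Rightarrow> real"
  assumes h: "\<And>k. k < p \<Longrightarrow> h k \<in> L2 M"
  shows "(\<Sum>k<p. \<Sum>l<p. (\<Sum>i<n. l2_inner M (h k) (ph i) * l2_inner M (h l) (ph i))\<^sup>2)
    \<le> (\<Sum>k<p. \<Sum>l<p. (l2_inner M (h k) (h l))\<^sup>2)"
proof -
  define g where "g k x = (\<Sum>i<n. l2_inner M (h k) (ph i) * ph i x)" for k x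
  have gL: "g k \<in> L2 M" for k unfolding g_def[abs_def] by (intro L2_sum L2_cmult ph_L2)
  define H where "H k l = (\<Sum>i<n. l2_inner M (h k) (ph i) * l2_inner M (h l) (ph i))" for k l
  have hg: "l2_inner M (h k) (g l) = H k l" if "k < p" for k l
  proof -
    have "l2_inner M (h k) (g l) = (\<Sum>i<n. l2_inner M (h k) (\<lambda>x. l2_inner M (h l) (ph i) * ph i x))"
      unfolding g_def[abs_def] using h[OF that]
      by (intro l2_inner_sum_right L2_cmult ph_L2)
    then show ?thesis unfolding H_def l2_inner_cmult_right by (simp only: ac_simps)
  qed
  have gg: "l2_inner M (g k) (g l) = H k l" if "l < p" for k l
  proof -
    have "l2_inner M (g k) (g l) = (\<Sum>i<n. l2_inner M (h k) (ph i) * l2_inner M (ph i) (g l))"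
      by (subst g_def[of k, abs_def])
        (simp add: l2_inner_sum_left L2_cmult ph_L2 gL l2_inner_cmult_left)
    then show ?thesis
      unfolding H_def g_def[of l, abs_def] using l2_inner_ph_proj[OF _ h[OF that], of _ n] by simp
  qed
  have "0 \<le> l2_inner (M \<Otimes>\<^sub>M M) (\<lambda>z. rank_kernel p h z - rank_kernel p g z) (\<lambda>z. rank_kernel p h z - rank_kernel p g z)"
    by (rule l2_inner_nonneg)
  also have "\<dots> = (\<Sum>k<p. \<Sum>l<p. (l2_inner M (h k) (h l))\<^sup>2) - 2 * (\<Sum>k<p. \<Sum>l<p. (H k l)\<^sup>2)
      + (\<Sum>k<p. \<Sum>l<p. (H k l)\<^sup>2)"
    by (simp add: l2_inner_diff_self rank_kernel_L2 h gL l2_inner_rank_kernel hg gg)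
  finally show ?thesis by (simp add: H_def)
qed

text \<open>Only the projections of the \<open>h k\<close> to the span of the first \<open>n\<close> eigenfunctions matter, up to an
  error that is controlled by \<open>L n\<close>.\<close>

lemma rank_kernel_gain_le:
  fixes h :: "nat \<Rightarrow> 'a \<Rightarrow> real"
  assumes h: "\<And>k. k < p \<Longrightarrow> h k \<in> L2 M"
  shows "2 * (\<Sum>k<p. l2_inner M (T (h k)) (h k)) - (\<Sum>k<p. \<Sum>l<p. (l2_inner M (h k) (h l))\<^sup>2)
    \<le> (\<Sum>i<p. (L i)\<^sup>2)"
proof -
  define G where "G = 2 * (\<Sum>k<p. l2_inner M (T (h k)) (h k)) - (\<Sum>k<p. \<Sum>l<p. (l2_inner M (h k) (h l))\<^sup>2)"
  define S where "S = (\<Sum>k<p. l2_inner M (h k) (h k))"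
  have bound: "G \<le> (\<Sum>i<p. (L i)\<^sup>2) + 2 * (L n * S)" for n
  proof -
    \<comment> \<open>The coefficients of \<open>h k\<close> are attached to unit vectors of
      \<open>ell2\<close>. These stay orthonormal even at indices where \<open>ph i\<close> is 0, as
      the Gram inequality demands.\<close>
    define a where "a k = (\<Sum>i<n. l2_inner M (h k) (ph i) *\<^sub>R unit_ell2 i)" for k
    have au: "inner (a k) (unit_ell2 j) = l2_inner M (h k) (ph j)" if "j < n" for k j
    proof -
      have "inner (a k) (unit_ell2 j) = (\<Sum>i<n. if i = j then l2_inner M (h k) (ph j) else 0)"
        unfolding a_def inner_sum_left
        by (intro sum.cong refl) (auto simp: inner_unit_ell2 coord_scaleR coord_unit_ell2)
      then show ?thesis using that by simp
    qed
    have aa: "inner (a k) (a l) = (\<Sum>i<n. l2_inner M (h k) (ph i) * l2_inner M (h l) (ph i))" for k l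
      by (subst (2) a_def) (simp add: inner_sum_right au mult.commute)
    have "(\<Sum>k<p. l2_inner M (T (h k)) (h k))
        \<le> (\<Sum>k<p. (\<Sum>i<n. L i * (l2_inner M (h k) (ph i))\<^sup>2) + L n * l2_inner M (h k) (h k))"
      by (intro sum_mono quadratic_form_bound h) simp
    also have "\<dots> = (\<Sum>k<p. \<Sum>i<n. L i * (inner (a k) (unit_ell2 i))\<^sup>2) + L n * S"
      by (simp add: sum.distrib S_def sum_distrib_left au)
    finally have 1: "(\<Sum>k<p. l2_inner M (T (h k)) (h k)) \<le> \<dots>" .
    have 2: "(\<Sum>k<p. \<Sum>l<p. (inner (a k) (a l))\<^sup>2) \<le> (\<Sum>k<p. \<Sum>l<p. (l2_inner M (h k) (h l))\<^sup>2)"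
      unfolding aa by (rule sum_l2_inner_squares_ge_proj[OF h])
    have 3: "2 * (\<Sum>k<p. \<Sum>i<n. L i * (inner (a k) (unit_ell2 i))\<^sup>2) - (\<Sum>k<p. \<Sum>l<p. (inner (a k) (a l))\<^sup>2)
        \<le> (\<Sum>i<p. (L i)\<^sup>2)"
      by (rule Gram_trace_inequality[OF _ decseq_L L_nonneg])
        (auto simp: inner_unit_ell2 coord_unit_ell2)
    show ?thesis unfolding G_def using 1 2 3 by linarith
  qed
  \<comment> \<open>\<open>G\<close> and \<open>S\<close> do not depend on \<open>n\<close>, so only
    \<open>L n\<close> moves in the limit.\<close>
  have "(\<lambda>n. (\<Sum>i<p. (L i)\<^sup>2) + 2 * (L n * S)) \<longlonglongrightarrow> (\<Sum>i<p. (L i)\<^sup>2) + 2 * (0 * S)"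
    by (intro tendsto_intros L_tendsto_0)
  then have "G \<le> (\<Sum>i<p. (L i)\<^sup>2) + 2 * (0 * S)"
    by (rule LIMSEQ_le_const) (use bound in auto)
  then show ?thesis by (simp add: G_def)
qed

lemma dist_K_rank_kernel_ge:
  assumes h: "\<And>k. k < p \<Longrightarrow> h k \<in> L2 M"
  shows "l2_inner (M \<Otimes>\<^sub>M M) Kp Kp - (\<Sum>i<p. (L i)\<^sup>2)
    \<le> l2_inner (M \<Otimes>\<^sub>M M) (\<lambda>z. Kp z - rank_kernel p h z) (\<lambda>z. Kp z - rank_kernel p h z)"
proof -
  have "l2_inner (M \<Otimes>\<^sub>M M) (\<lambda>z. Kp z - rank_kernel p h z) (\<lambda>z. Kp z - rank_kernel p h z)
    = l2_inner (M \<Otimes>\<^sub>M M) Kp Kp - 2 * (\<Sum>k<p. l2_inner M (T (h k)) (h k))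
      + (\<Sum>k<p. \<Sum>l<p. (l2_inner M (h k) (h l))\<^sup>2)"
    using l2_inner_diff_self[OF K_L2 rank_kernel_L2, of p h] h
    by (simp add: l2_inner_rank_kernel l2_inner_K_rank_kernel)
  then show ?thesis using rank_kernel_gain_le[of p h] h by simp
qed

section \<open>Extension of the lower bound to limits of finite-rank kernels\<close>

lemma dist_K_limit_ge:
  assumes C: "C \<in> L2 (M \<Otimes>\<^sub>M M)" and u: "\<And>n. u n \<in> L2 (M \<Otimes>\<^sub>M M)"
    and lim: "(\<lambda>n. l2_inner (M \<Otimes>\<^sub>M M) (\<lambda>z. u n z - C z) (\<lambda>z. u n z - C z)) \<longlonglongrightarrow> 0"
    and ge: "\<And>n. c \<le> l2_inner (M \<Otimes>\<^sub>M M) (\<lambda>z. Kp z - u n z) (\<lambda>z. Kp z - u n z)"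
  shows "c \<le> l2_inner (M \<Otimes>\<^sub>M M) (\<lambda>z. Kp z - C z) (\<lambda>z. Kp z - C z)"
  by (rule LIMSEQ_le_const[OF l2_dist_tendsto[OF K_L2 u C lim]]) (use ge in auto)

lemma eventually_truncation:
  "\<forall>\<^sub>F n in sequentially. w (fst z) \<le> real n \<and> w (snd z) \<le> real n"
proof -
  obtain m where "max (w (fst z)) (w (snd z)) \<le> real m" using real_arch_simple by blast
  then show ?thesis by (intro eventually_sequentiallyI[of m]) auto
qed

lemma truncation_sets:
  assumes w: "w \<in> borel_measurable M"
  shows "{z \<in> space (M \<Otimes>\<^sub>M M). w (fst z) \<le> real n \<and> w (snd z) \<le> real n} \<in> sets (M \<Otimes>\<^sub>M M)"
  using w by measurable

text \<open>Square integrability of the kernel does not directly give that of the coordinates.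
  Cutting both arguments off where the squared length \<open>w\<close> exceeds \<open>n\<close>
  leaves a kernel of the same rank \<open>p\<close> with bounded coordinates, so the bound with the
  same \<open>p\<close> applies before the limit.\<close>

lemma dist_K_finite_rank_ge:
  assumes h: "\<And>k. k < p \<Longrightarrow> h k \<in> borel_measurable M" and C: "rank_kernel p h \<in> L2 (M \<Otimes>\<^sub>M M)"
  shows "l2_inner (M \<Otimes>\<^sub>M M) Kp Kp - (\<Sum>i<p. (L i)\<^sup>2)
    \<le> l2_inner (M \<Otimes>\<^sub>M M) (\<lambda>z. Kp z - rank_kernel p h z) (\<lambda>z. Kp z - rank_kernel p h z)"
proof -
  define w where "w x = (\<Sum>k<p. (h k x)\<^sup>2)" for x
  have w: "w \<in> borel_measurable M"
    unfolding w_def[abs_def] using h by (intro borel_measurable_sum borel_measurable_power) auto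
  let ?E = "\<lambda>n z. w (fst z) \<le> real n \<and> w (snd z) \<le> real n"
  show ?thesis
  proof (rule dist_K_limit_ge[OF C])
    show "(\<lambda>z. if ?E n z then rank_kernel p h z else 0) \<in> L2 (M \<Otimes>\<^sub>M M)" for n
      by (rule L2_truncation(1)[OF C truncation_sets[OF w] eventually_truncation])
    show "(\<lambda>n. l2_inner (M \<Otimes>\<^sub>M M) (\<lambda>z. (if ?E n z then rank_kernel p h z else 0) - rank_kernel p h z)
        (\<lambda>z. (if ?E n z then rank_kernel p h z else 0) - rank_kernel p h z)) \<longlonglongrightarrow> 0"
      by (rule L2_truncation(2)[OF C truncation_sets[OF w] eventually_truncation])
    fix n
    define g where "g k x = (if w x \<le> real n then h k x else 0)" for k x
    have "g k \<in> L2 M" if "k < p" for k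
    proof (rule L2_bounded[OF finite_measure_axioms, of _ "sqrt (real n)"])
      show "g k \<in> borel_measurable M"
        unfolding g_def[abs_def] using h[OF that] w by measurable
      fix x
      have "(h k x)\<^sup>2 \<le> w x" unfolding w_def using that by (intro member_le_sum) auto
      then show "\<bar>g k x\<bar> \<le> sqrt (real n)"
        by (auto simp: g_def intro!: real_le_rsqrt)
    qed
    moreover have "(\<lambda>z. if ?E n z then rank_kernel p h z else 0) = rank_kernel p g"
      by (auto simp: rank_kernel_def tensor_def g_def fun_eq_iff intro!: sum.cong sum.neutral)
    ultimately show "l2_inner (M \<Otimes>\<^sub>M M) Kp Kp - (\<Sum>i<p. (L i)\<^sup>2)
      \<le> l2_inner (M \<Otimes>\<^sub>M M) (\<lambda>z. Kp z - (if ?E n z then rank_kernel p h z else 0))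
          (\<lambda>z. Kp z - (if ?E n z then rank_kernel p h z else 0))"
      using dist_K_rank_kernel_ge[of p g] by metis
  qed
qed

text \<open>Two nested limits. For a fixed cutoff \<open>n\<close> of the squared length,
  Cauchy-Schwarz bounds the partial kernels by \<open>n\<close>, so dominated convergence lets the
  rank \<open>p\<close> tend to infinity; then \<open>n\<close> does. Replacing the sum up to
  \<open>p\<close> by the full series makes the lower bound independent of both.\<close>

lemma dist_K_ell2_kernel_ge:
  assumes g: "\<And>k. (\<lambda>x. coord (g x) k) \<in> borel_measurable M"
    and C: "(\<lambda>(x, t). inner (g x) (g t)) \<in> L2 (M \<Otimes>\<^sub>M M)"
  shows "l2_inner (M \<Otimes>\<^sub>M M) Kp Kp - (\<Sum>i. (L i)\<^sup>2)
    \<le> l2_inner (M \<Otimes>\<^sub>M M) (\<lambda>z. Kp z - (case z of (x, t) \<Rightarrow> inner (g x) (g t)))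
        (\<lambda>z. Kp z - (case z of (x, t) \<Rightarrow> inner (g x) (g t)))"
proof -
  define w where "w x = (norm (g x))\<^sup>2" for x
  have w_eq: "w x = (\<Sum>k. (coord (g x) k)\<^sup>2)" for x
    by (simp add: w_def norm_ell2_def suminf_nonneg summable_coord_square)
  have w: "w \<in> borel_measurable M"
    unfolding w_eq[abs_def] using g by (intro borel_measurable_suminf borel_measurable_power)
  let ?E = "\<lambda>n z. w (fst z) \<le> real n \<and> w (snd z) \<le> real n"
  let ?C = "\<lambda>(x, t). inner (g x) (g t)"
  show ?thesis
  proof (rule dist_K_limit_ge[OF C])
    show EL: "(\<lambda>z. if ?E n z then ?C z else 0) \<in> L2 (M \<Otimes>\<^sub>M M)" for n
      by (rule L2_truncation(1)[OF C truncation_sets[OF w] eventually_truncation])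
    show "(\<lambda>n. l2_inner (M \<Otimes>\<^sub>M M) (\<lambda>z. (if ?E n z then ?C z else 0) - ?C z)
        (\<lambda>z. (if ?E n z then ?C z else 0) - ?C z)) \<longlonglongrightarrow> 0"
      by (rule L2_truncation(2)[OF C truncation_sets[OF w] eventually_truncation])
    fix n
    define h where "h k x = (if w x \<le> real n then coord (g x) k else 0)" for k x
    have h_meas: "h k \<in> borel_measurable M" for k
      unfolding h_def[abs_def] using g[of k] w by measurable
    have h_sum: "(\<Sum>k<p. (h k x)\<^sup>2) \<le> real n" for p x
    proof (cases "w x \<le> real n")
      case True
      have "(\<Sum>k<p. (coord (g x) k)\<^sup>2) \<le> w x"
        unfolding w_eq by (intro sum_le_suminf summable_coord_square) auto
      then show ?thesis using True by (simp add: h_def)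
    qed (simp add: h_def)
    have hL: "h k \<in> L2 M" for k
    proof (rule L2_bounded[OF finite_measure_axioms h_meas, of _ "sqrt (real n)"])
      fix x
      have "(h k x)\<^sup>2 \<le> (\<Sum>k<Suc k. (h k x)\<^sup>2)" by (rule member_le_sum) auto
      then have "(h k x)\<^sup>2 \<le> real n" using h_sum[of x "Suc k"] by linarith
      then show "\<bar>h k x\<bar> \<le> sqrt (real n)" by (auto intro!: real_le_rsqrt)
    qed
    show "l2_inner (M \<Otimes>\<^sub>M M) Kp Kp - (\<Sum>i. (L i)\<^sup>2)
      \<le> l2_inner (M \<Otimes>\<^sub>M M) (\<lambda>z. Kp z - (if ?E n z then ?C z else 0))
          (\<lambda>z. Kp z - (if ?E n z then ?C z else 0))"
    proof (rule dist_K_limit_ge[OF EL])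
      show hpL: "rank_kernel p h \<in> L2 (M \<Otimes>\<^sub>M M)" for p by (intro rank_kernel_L2 hL)
      show "(\<lambda>p. l2_inner (M \<Otimes>\<^sub>M M) (\<lambda>z. rank_kernel p h z - (if ?E n z then ?C z else 0))
        (\<lambda>z. rank_kernel p h z - (if ?E n z then ?C z else 0))) \<longlonglongrightarrow> 0"
      proof (rule L2_dominated_convergence[OF P.finite_measure_axioms])
        show "rank_kernel p h \<in> borel_measurable (M \<Otimes>\<^sub>M M)" for p by (rule L2_measurable[OF hpL])
        show "(\<lambda>z. if ?E n z then ?C z else 0) \<in> borel_measurable (M \<Otimes>\<^sub>M M)"
          by (rule L2_measurable[OF EL])
        show "\<bar>rank_kernel p h z\<bar> \<le> real n" for p z
        proof -
          obtain x t where z: "z = (x, t)" by (cases z)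
          have "(\<Sum>k<p. h k x * h k t)\<^sup>2 \<le> (\<Sum>k<p. (h k x)\<^sup>2) * (\<Sum>k<p. (h k t)\<^sup>2)"
            by (rule Cauchy_Schwarz_ineq_sum)
          also have "\<dots> \<le> real n * real n"
            by (intro mult_mono h_sum) (auto intro: sum_nonneg)
          finally have "(rank_kernel p h z)\<^sup>2 \<le> (real n)\<^sup>2"
            by (simp add: z rank_kernel_def tensor_def power2_eq_square)
          then show ?thesis by (simp add: abs_le_square_iff[symmetric])
        qed
        show "(\<lambda>p. rank_kernel p h z) \<longlonglongrightarrow> (if ?E n z then ?C z else 0)" for z
        proof (cases "?E n z")
          case True
          then have "(\<lambda>p. rank_kernel p h z) = (\<lambda>p. \<Sum>k<p. coord (g (fst z)) k * coord (g (snd z)) k)"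
            by (auto simp: rank_kernel_def tensor_def h_def case_prod_beta)
          then show ?thesis
            using True summable_LIMSEQ[OF summable_coord_mult[of "g (fst z)" "g (snd z)"]]
            by (simp add: inner_ell2_def case_prod_beta)
        next
          case False
          then have "rank_kernel p h z = 0" for p
            by (auto simp: rank_kernel_def tensor_def h_def case_prod_beta)
          then show ?thesis using False by auto
        qed
      qed
      fix p
      have "(\<Sum>i<p. (L i)\<^sup>2) \<le> (\<Sum>i. (L i)\<^sup>2)"
        by (intro sum_le_suminf summable_L_squares) auto
      then show "l2_inner (M \<Otimes>\<^sub>M M) Kp Kp - (\<Sum>i. (L i)\<^sup>2)
        \<le> l2_inner (M \<Otimes>\<^sub>M M) (\<lambda>z. Kp z - rank_kernel p h z) (\<lambda>z. Kp z - rank_kernel p h z)"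
        using dist_K_rank_kernel_ge[of p h] hL by fastforce
    qed
  qed
qed

end

section \<open>The MDS kernel\<close>

lemma strict_mono_majorant:
  fixes f :: "nat \<Rightarrow> nat"
  obtains r where "strict_mono r" "\<And>n. f n \<le> r n"
proof
  define r where "r n = (\<Sum>i\<le>n. Suc (f i))" for n
  show "strict_mono r" by (simp add: strict_mono_Suc_iff r_def)
  show "f n \<le> r n" for n
    using member_le_sum[of n "{..n}" "\<lambda>i. Suc (f i)"] by (simp add: r_def)
qed

context lipschitz_kernel_eigenpairs
begin

definition tail :: "nat \<Rightarrow> real" where
  "tail n = (\<Sum>i. (L i)\<^sup>2) - (\<Sum>i<n. (L i)\<^sup>2)"

lemma tail_nonneg: "0 \<le> tail n"
  unfolding tail_def using sum_le_suminf[OF summable_L_squares, of "{..<n}"] by simp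

lemma tail_tendsto_0: "tail \<longlonglongrightarrow> 0"
proof -
  have "tail \<longlonglongrightarrow> (\<Sum>i. (L i)\<^sup>2) - (\<Sum>i. (L i)\<^sup>2)"
    unfolding tail_def by (intro tendsto_intros summable_LIMSEQ summable_L_squares)
  then show ?thesis by simp
qed

lemma mc_kernel_L2: "rank_kernel n mc \<in> L2 (M \<Otimes>\<^sub>M M)"
  by (intro rank_kernel_L2 mc_L2)

lemma dist_mc_kernels:
  assumes "n \<le> m"
  shows "l2_inner (M \<Otimes>\<^sub>M M) (\<lambda>z. rank_kernel m mc z - rank_kernel n mc z)
      (\<lambda>z. rank_kernel m mc z - rank_kernel n mc z) \<le> tail n"
proof -
  have "l2_inner (M \<Otimes>\<^sub>M M) (rank_kernel m mc) (rank_kernel n mc) = (\<Sum>i<n. (L i)\<^sup>2)"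
    using l2_inner_mc_kernel[OF assms] by (simp add: l2_inner_commute)
  then have "l2_inner (M \<Otimes>\<^sub>M M) (\<lambda>z. rank_kernel m mc z - rank_kernel n mc z)
      (\<lambda>z. rank_kernel m mc z - rank_kernel n mc z) = (\<Sum>i<m. (L i)\<^sup>2) - (\<Sum>i<n. (L i)\<^sup>2)"
    by (simp add: l2_inner_diff_self mc_kernel_L2 l2_inner_mc_kernel)
  then show ?thesis using tail_nonneg[of m] by (simp add: tail_def)
qed

text \<open>Fix \<open>n\<close> and apply Fatou along the subsequence to its difference from the
  \<open>n\<close>-th kernel, which has squared norm at most \<open>tail n\<close> once
  \<open>r k\<close> is at least \<open>n\<close>. So an almost everywhere limit of a subsequence is
  already the L2-limit of the whole sequence. This serves both the pointwise embedding and the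
  abstract kernel.\<close>

lemma mc_kernel_AE_limit:
  assumes r: "strict_mono r" and B: "B \<in> borel_measurable (M \<Otimes>\<^sub>M M)"
    and lim: "AE z in M \<Otimes>\<^sub>M M. (\<lambda>k. rank_kernel (r k) mc z) \<longlonglongrightarrow> B z"
  shows "B \<in> L2 (M \<Otimes>\<^sub>M M)"
    and "(\<lambda>n. l2_inner (M \<Otimes>\<^sub>M M) (\<lambda>z. B z - rank_kernel n mc z) (\<lambda>z. B z - rank_kernel n mc z)) \<longlonglongrightarrow> 0"
proof -
  have diff: "(\<lambda>z. B z - rank_kernel n mc z) \<in> L2 (M \<Otimes>\<^sub>M M)"
    "l2_inner (M \<Otimes>\<^sub>M M) (\<lambda>z. B z - rank_kernel n mc z) (\<lambda>z. B z - rank_kernel n mc z) \<le> tail n" for n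
  proof -
    let ?u = "\<lambda>k z. rank_kernel (r k) mc z - rank_kernel n mc z"
    have u: "?u k \<in> L2 (M \<Otimes>\<^sub>M M)" for k by (intro L2_diff mc_kernel_L2)
    have v: "(\<lambda>z. B z - rank_kernel n mc z) \<in> borel_measurable (M \<Otimes>\<^sub>M M)"
      by (intro borel_measurable_diff B L2_measurable mc_kernel_L2)
    have l: "AE z in M \<Otimes>\<^sub>M M. (\<lambda>k. ?u k z) \<longlonglongrightarrow> B z - rank_kernel n mc z"
      using lim by eventually_elim (intro tendsto_intros)
    have e: "\<forall>\<^sub>F k in sequentially. l2_inner (M \<Otimes>\<^sub>M M) (?u k) (?u k) \<le> tail n"
      using eventually_ge_at_top[of n]
    proof eventually_elim
      case (elim k)
      then show ?case using seq_suble[OF r, of k] by (intro dist_mc_kernels) simp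
    qed
    show "(\<lambda>z. B z - rank_kernel n mc z) \<in> L2 (M \<Otimes>\<^sub>M M)"
      "l2_inner (M \<Otimes>\<^sub>M M) (\<lambda>z. B z - rank_kernel n mc z) (\<lambda>z. B z - rank_kernel n mc z) \<le> tail n"
      using L2_Fatou[OF u v l e] by blast+
  qed
  show "B \<in> L2 (M \<Otimes>\<^sub>M M)"
    using L2_add[OF diff(1)[of 0] mc_kernel_L2[of 0]] by simp
  show "(\<lambda>n. l2_inner (M \<Otimes>\<^sub>M M) (\<lambda>z. B z - rank_kernel n mc z) (\<lambda>z. B z - rank_kernel n mc z)) \<longlonglongrightarrow> 0"
    by (rule tendsto_sandwich[OF _ _ tendsto_const tail_tendsto_0]) (simp_all add: l2_inner_nonneg diff(2))
qed

text \<open>Completeness done by hand: the sequence is thinned until successive kernels are at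
  squared distance at most 4 to the power -n, which yields almost everywhere convergence.\<close>

lemma mc_kernel_limit_exists:
  obtains B where "B \<in> L2 (M \<Otimes>\<^sub>M M)"
    "(\<lambda>n. l2_inner (M \<Otimes>\<^sub>M M) (\<lambda>z. B z - rank_kernel n mc z) (\<lambda>z. B z - rank_kernel n mc z)) \<longlonglongrightarrow> 0"
proof -
  have "\<exists>N. \<forall>m\<ge>N. tail m \<le> (1/4) ^ n" for n
  proof -
    have "\<forall>\<^sub>F m in sequentially. tail m < (1/4) ^ n"
      by (rule order_tendstoD(2)[OF tail_tendsto_0]) simp
    then show ?thesis by (auto simp: eventually_sequentially intro: less_imp_le)
  qed
  then obtain f where f: "\<And>n m. f n \<le> m \<Longrightarrow> tail m \<le> (1/4) ^ n" by metis
  obtain r where r: "strict_mono r" "\<And>n. f n \<le> r n" using strict_mono_majorant[of f] by blast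
  define u where "u n = rank_kernel (r n) mc" for n
  have uL: "u n \<in> L2 (M \<Otimes>\<^sub>M M)" for n by (simp add: u_def mc_kernel_L2)
  have "AE z in M \<Otimes>\<^sub>M M. convergent (\<lambda>n. u n z)"
  proof (rule P.L2_summable_increments_AE_convergent[OF uL])
    fix n
    have "r n \<le> r (Suc n)" using r(1) by (simp add: strict_mono_less_eq)
    then show "l2_inner (M \<Otimes>\<^sub>M M) (\<lambda>z. u (Suc n) z - u n z) (\<lambda>z. u (Suc n) z - u n z) \<le> (1/4) ^ n"
      unfolding u_def by (rule order_trans[OF dist_mc_kernels f[OF r(2)]])
  qed
  then have lim: "AE z in M \<Otimes>\<^sub>M M. (\<lambda>k. rank_kernel (r k) mc z) \<longlonglongrightarrow> lim (\<lambda>n. u n z)"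
    by eventually_elim (simp add: u_def convergent_LIMSEQ_iff)
  have "(\<lambda>z. lim (\<lambda>n. u n z)) \<in> borel_measurable (M \<Otimes>\<^sub>M M)"
    by (intro borel_measurable_lim_metric L2_measurable uL)
  from mc_kernel_AE_limit[OF r(1) this lim] show thesis by (rule that)
qed

lemma dist_K_mc_kernel_limit:
  assumes B: "B \<in> L2 (M \<Otimes>\<^sub>M M)"
    and lim: "(\<lambda>n. l2_inner (M \<Otimes>\<^sub>M M) (\<lambda>z. B z - rank_kernel n mc z) (\<lambda>z. B z - rank_kernel n mc z)) \<longlonglongrightarrow> 0"
  shows "l2_inner (M \<Otimes>\<^sub>M M) (\<lambda>z. Kp z - B z) (\<lambda>z. Kp z - B z)
    = l2_inner (M \<Otimes>\<^sub>M M) Kp Kp - (\<Sum>i. (L i)\<^sup>2)"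
proof (rule LIMSEQ_unique)
  have "(\<lambda>n. l2_inner (M \<Otimes>\<^sub>M M) (\<lambda>z. rank_kernel n mc z - B z) (\<lambda>z. rank_kernel n mc z - B z)) \<longlonglongrightarrow> 0"
    using lim by (simp add: l2_inner_diff_self B mc_kernel_L2 l2_inner_commute[of _ B "rank_kernel _ mc"] algebra_simps)
  then show "(\<lambda>n. l2_inner (M \<Otimes>\<^sub>M M) (\<lambda>z. Kp z - rank_kernel n mc z) (\<lambda>z. Kp z - rank_kernel n mc z))
      \<longlonglongrightarrow> l2_inner (M \<Otimes>\<^sub>M M) (\<lambda>z. Kp z - B z) (\<lambda>z. Kp z - B z)"
    by (rule l2_dist_tendsto[OF K_L2 mc_kernel_L2 B])
  show "(\<lambda>n. l2_inner (M \<Otimes>\<^sub>M M) (\<lambda>z. Kp z - rank_kernel n mc z) (\<lambda>z. Kp z - rank_kernel n mc z))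
      \<longlonglongrightarrow> l2_inner (M \<Otimes>\<^sub>M M) Kp Kp - (\<Sum>i. (L i)\<^sup>2)"
    unfolding dist_K_mc_kernel by (intro tendsto_intros summable_LIMSEQ summable_L_squares)
qed

end

section \<open>Measurability of maps into the sequence space\<close>

lemma borel_measurable_coord:
  assumes "f \<in> borel_measurable M" shows "(\<lambda>x. coord (f x) k) \<in> borel_measurable M"
proof -
  have "(\<lambda>u. inner u (unit_ell2 k)) \<in> borel_measurable borel"
    by (intro borel_measurable_continuous_onI continuous_intros)
  from measurable_compose[OF assms this] show ?thesis by (simp add: inner_unit_ell2)
qed

text \<open>Finite truncations are continuous functions of the coordinate sequence in the product
  topology, and they converge to the vector in norm. This is how the embedding, given only by its
  coordinates, is seen to be admissible.\<close>

lemma borel_measurable_ell2I: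
  assumes f: "\<And>k. (\<lambda>x. coord (f x) k) \<in> borel_measurable M"
  shows "f \<in> borel_measurable M"
proof (rule borel_measurable_LIMSEQ_metric)
  define G :: "nat \<Rightarrow> (nat \<Rightarrow> real) \<Rightarrow> ell2" where "G n c = (\<Sum>k<n. c k *\<^sub>R unit_ell2 k)" for n c
  have G: "G n \<in> borel_measurable borel" for n
    unfolding G_def[abs_def]
    by (intro borel_measurable_continuous_onI continuous_on_sum continuous_on_scaleR continuous_on_const) simp
  have "(\<lambda>x. coord (f x)) \<in> M \<rightarrow>\<^sub>M borel"
    by (rule measurable_coordinatewise_then_product) (rule f)
  then show "(\<lambda>x. G n (coord (f x))) \<in> borel_measurable M" for n
    using G by (rule measurable_compose)
  show "(\<lambda>n. G n (coord (f x))) \<longlonglongrightarrow> f x" for x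
  proof -
    let ?u = "f x"
    have coord_G: "coord (G n c) j = (if j < n then c j else 0)" for n c j
    proof (induction n)
      case (Suc n)
      have "coord (G (Suc n) c) j = coord (G n c) j + coord (c n *\<^sub>R unit_ell2 n) j"
        by (simp add: G_def coord_plus)
      then show ?case using Suc by (auto simp: coord_scaleR coord_unit_ell2 less_Suc_eq)
    qed (simp add: G_def coord_zero)
    have norm_eq: "norm (G n (coord ?u) - ?u) = sqrt ((\<Sum>k. (coord ?u k)\<^sup>2) - (\<Sum>k<n. (coord ?u k)\<^sup>2))" for n
    proof -
      let ?c = "\<lambda>k. if k < n then (coord ?u k)\<^sup>2 else 0"
      have c: "summable ?c" "suminf ?c = (\<Sum>k<n. (coord ?u k)\<^sup>2)"
        using sums_If_finite_set[of "{..<n}" "\<lambda>k. (coord ?u k)\<^sup>2"]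
        by (auto simp: sums_iff)
      have "(\<lambda>k. (coord (G n (coord ?u) - ?u) k)\<^sup>2) = (\<lambda>k. (coord ?u k)\<^sup>2 - ?c k)"
        by (auto simp: coord_minus coord_G fun_eq_iff)
      then show ?thesis
        unfolding norm_ell2_def using suminf_diff[OF summable_coord_square c(1), of ?u] c(2) by simp
    qed
    have "(\<lambda>n. norm (G n (coord ?u) - ?u)) \<longlonglongrightarrow> sqrt ((\<Sum>k. (coord ?u k)\<^sup>2) - (\<Sum>k. (coord ?u k)\<^sup>2))"
      unfolding norm_eq
      by (intro tendsto_real_sqrt tendsto_diff tendsto_const summable_LIMSEQ summable_coord_square)
    then have "(\<lambda>n. norm (G n (coord ?u) - ?u)) \<longlonglongrightarrow> 0" by simp
    then show ?thesis by (rule LIM_zero_cancel[OF tendsto_norm_zero_cancel])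
  qed
qed

section \<open>The doubly centered kernel\<close>

lemma (in prob_space) abs_expectation_le:
  fixes f :: "'a \<Rightarrow> real"
  assumes f: "f \<in> borel_measurable M" and le: "\<And>x. \<bar>f x\<bar> \<le> c"
  shows "\<bar>\<integral>x. f x \<partial>M\<bar> \<le> c"
proof -
  have int: "integrable M f" by (rule integrable_const_bound[where B=c]) (use f le in auto)
  have "\<bar>\<integral>x. f x \<partial>M\<bar> \<le> (\<integral>x. norm (f x) \<partial>M)"
    using integral_norm_bound[of M f] by simp
  also have "\<dots> \<le> (\<integral>x. c \<partial>M)"
    by (intro integral_mono integrable_norm int) (simp_all add: le)
  finally show ?thesis by (simp add: prob_space)
qed

text \<open>A difference of squared distances factors into a difference, at most
  \<open>dist x y\<close>, and a sum, at most twice the diameter bound \<open>D\<close>. With the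
  factor 1/2 this gives Lipschitz constant \<open>D\<close>, which averaging over a probability
  measure preserves.\<close>

lemma lipschitz_kernel_B:
  fixes M :: "'a::metric_space measure"
  assumes mms: "metric_measure_space M"
  obtains kb lc where "lipschitz_kernel M (kernel_B M) kb lc"
proof -
  interpret metric_measure_space M by (rule mms)
  interpret P: pair_prob_space M M ..
  have sp: "space M = UNIV" using sets_eq_imp_space_eq[OF sets_borel] by simp
  obtain D where D: "\<And>x y :: 'a. dist x y \<le> D"
    using compact_imp_bounded[OF compact_space] by (auto simp: bounded_two_points)
  have D0: "0 \<le> D" using D[of undefined undefined] by simp
  define A where "A x s = kernel_A x s" for x s :: 'a
  have A_eq: "A x s = - (1/2) * (dist x s)\<^sup>2" for x s by (simp add: A_def kernel_A_def)
  have A_sym: "A x s = A s x" for x s by (simp add: A_eq dist_commute)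
  have A_bound: "\<bar>A x s\<bar> \<le> D\<^sup>2" for x s
  proof -
    have "(dist x s)\<^sup>2 \<le> D\<^sup>2" using D[of x s] by (intro power_mono) auto
    then show ?thesis
      unfolding A_eq using zero_le_power2[of "dist x s"] zero_le_power2[of D] by linarith
  qed
  have A_lip: "\<bar>A x s - A y s\<bar> \<le> D * dist x y" for x y s
  proof -
    have 1: "\<bar>dist x s - dist y s\<bar> \<le> dist x y"
      using dist_triangle[of x s y] dist_triangle[of y s x] by (simp add: dist_commute abs_le_iff)
    have 2: "\<bar>dist x s + dist y s\<bar> \<le> 2 * D" using D[of x s] D[of y s] by simp
    have "A x s - A y s = - (1/2) * ((dist x s - dist y s) * (dist x s + dist y s))"
      by (simp add: A_eq power2_eq_square algebra_simps)
    then have "\<bar>A x s - A y s\<bar> = 1/2 * (\<bar>dist x s - dist y s\<bar> * \<bar>dist x s + dist y s\<bar>)"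
      by (simp add: abs_mult)
    also have "\<dots> \<le> 1/2 * (dist x y * (2 * D))"
      by (intro mult_left_mono mult_mono 1 2) auto
    finally show ?thesis by (simp add: mult.commute)
  qed
  have A_meas: "(\<lambda>(x, s). A x s) \<in> borel_measurable (M \<Otimes>\<^sub>M M)"
  proof -
    note [measurable] = borel_measurable_dist_compact[OF compact_space sets_borel]
    have "(\<lambda>z. - (1/2) * ((\<lambda>(x, s). dist x s) z)\<^sup>2) \<in> borel_measurable (M \<Otimes>\<^sub>M M)"
      by measurable
    then show ?thesis by (simp add: A_eq case_prod_beta)
  qed
  have A_sec: "A x \<in> borel_measurable M" for x
    using measurable_compose[OF measurable_Pair1'[of x M M] A_meas] by (simp add: sp)
  have A_int: "integrable M (A x)" for x
    by (rule integrable_const_bound[where B="D\<^sup>2"]) (use A_sec A_bound in auto)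
  define h where "h x = (\<integral>z. A x z \<partial>M)" for x
  have h_meas: "h \<in> borel_measurable M"
    unfolding h_def[abs_def] using A_meas by (rule borel_measurable_lebesgue_integral)
  have h_bound: "\<bar>h x\<bar> \<le> D\<^sup>2" for x
    unfolding h_def by (rule abs_expectation_le[OF A_sec A_bound])
  have h_lip: "\<bar>h x - h y\<bar> \<le> D * dist x y" for x y
  proof -
    have "h x - h y = (\<integral>s. A x s - A y s \<partial>M)" by (simp add: h_def A_int)
    then show ?thesis
      using abs_expectation_le[OF borel_measurable_diff[OF A_sec A_sec] A_lip] by simp
  qed
  define c where "c = (\<integral>(w, z). A w z \<partial>(M \<Otimes>\<^sub>M M))"
  have c_bound: "\<bar>c\<bar> \<le> D\<^sup>2"
    unfolding c_def by (rule P.abs_expectation_le[OF A_meas]) (auto simp: A_bound)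
  have B_eq: "kernel_B M x s = A x s - h s - h x + c" for x s
    unfolding kernel_B_def A_def[symmetric] h_def c_def A_sym[of _ s] ..
  \<comment> \<open>Four terms bounded by the square of \<open>D\<close> give the first constant.
    For the second, only \<open>A x s\<close> and \<open>h x\<close> vary with \<open>x\<close>,
    each with Lipschitz constant \<open>D\<close>.\<close>
  have "lipschitz_kernel M (kernel_B M) (4 * D\<^sup>2) (2 * D)"
  proof unfold_locales
    have "(\<lambda>z. (\<lambda>(x, s). A x s) z - h (snd z) - h (fst z) + c) \<in> borel_measurable (M \<Otimes>\<^sub>M M)"
      using A_meas h_meas by measurable
    then show "(\<lambda>(x, t). kernel_B M x t) \<in> borel_measurable (M \<Otimes>\<^sub>M M)"
      by (simp add: B_eq case_prod_beta)
    fix x y t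
    show "kernel_B M x t = kernel_B M t x" by (simp add: B_eq A_sym[of x t])
    show "\<bar>kernel_B M x t\<bar> \<le> 4 * D\<^sup>2"
      using A_bound[of x t] h_bound[of x] h_bound[of t] c_bound unfolding B_eq by linarith
    show "\<bar>kernel_B M x t - kernel_B M y t\<bar> \<le> 2 * D * dist x y"
      using A_lip[of x t y] h_lip[of x y] unfolding B_eq by linarith
    show "0 \<le> 2 * D" using D0 by simp
  qed
  then show thesis by (rule that)
qed

lemma (in pair_sigma_finite) iterated_integral_square:
  assumes "(\<lambda>(x, t). F x t) \<in> L2 (M1 \<Otimes>\<^sub>M M2)"
  shows "(\<integral>x. (\<integral>t. (F x t)\<^sup>2 \<partial>M2) \<partial>M1)
    = l2_inner (M1 \<Otimes>\<^sub>M M2) (\<lambda>(x, t). F x t) (\<lambda>(x, t). F x t)"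
  using integral_fst'[OF L2_integrable_square[OF assms]]
  by (simp add: l2_inner_def power2_eq_square)

theorem theorem6p4p3:
  fixes M :: "'a::metric_space measure"
    and lam :: "nat \<Rightarrow> real"
    and phi :: "nat \<Rightarrow> 'a \<Rightarrow> real"
  assumes "metric_measure_space M"
    and "bounded (UNIV :: 'a set)"
    and "lists_positive_eigenpairs M (kernel_B M) lam phi"
  shows "(\<forall>f :: 'a \<Rightarrow> ell2. is_mds_embedding lam phi f \<longrightarrow>
            is_arg_min (strain M) (admissible M) f) \<and>
         (\<exists>B. is_mds_kernel M lam phi B \<and>
            (\<forall>g :: 'a \<Rightarrow> ell2. admissible M g \<longrightarrow> kernel_strain M B \<le> strain M g)) \<and>
         (\<forall>\<iota> :: 'm::finite \<Rightarrow> nat. bij_betw \<iota> UNIV {..<CARD('m)} \<longrightarrow>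
            is_arg_min (strain M) (admissible M) (mds_embedding_Rm \<iota> lam phi))"
proof -
  obtain kb lc where "lipschitz_kernel M (kernel_B M) kb lc"
    using lipschitz_kernel_B[OF assms(1)] by blast
  then interpret lipschitz_kernel_eigenpairs M "kernel_B M" kb lc lam phi
    using assms(3) by (intro lipschitz_kernel_eigenpairs.intro lipschitz_kernel_eigenpairs_axioms.intro)
  let ?MM = "M \<Otimes>\<^sub>M M"
  \<comment> \<open>The strain is an iterated integral; for square-integrable kernels Fubini makes
    it a squared L2 distance on the product.\<close>
  have strain_eq: "kernel_strain M B = l2_inner ?MM (\<lambda>z. Kp z - F z) (\<lambda>z. Kp z - F z)"
    if F: "F \<in> L2 ?MM" and "F = (\<lambda>(x, t). B x t)" for F B
  proof -
    have "(\<lambda>(x, t). kernel_B M x t - B x t) = (\<lambda>z. Kp z - F z)" using that(2) by auto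
    then show ?thesis
      using P.iterated_integral_square[of "\<lambda>x t. kernel_B M x t - B x t"] L2_diff[OF K_L2 F]
      by (simp add: kernel_strain_def)
  qed
  \<comment> \<open>This bound serves both infinite-dimensional claims: the embedding, when it
    exists, and the abstract kernel attain the same value.\<close>
  have lower: "l2_inner ?MM Kp Kp - (\<Sum>i. (L i)\<^sup>2) \<le> strain M g" if "admissible M g" for g :: "'a \<Rightarrow> ell2"
  proof -
    have g: "g \<in> borel_measurable M" "(\<lambda>(x, t). inner (g x) (g t)) \<in> L2 ?MM"
      using that by (auto simp: admissible_def)
    show ?thesis
      unfolding strain_def strain_eq[OF g(2) refl]
      by (rule dist_K_ell2_kernel_ge[OF borel_measurable_coord[OF g(1)] g(2)])
  qed
  have embedding: "is_arg_min (strain M) (admissible M) f" if f: "is_mds_embedding lam phi f" for f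
  proof -
    have coord_f: "coord (f x) i = mc i x" for x i
      using f by (simp add: is_mds_embedding_def mds_coord_eq_mc)
    have mc_meas: "mc i \<in> borel_measurable M" for i by (rule L2_measurable[OF mc_L2])
    have f_meas: "f \<in> borel_measurable M"
      by (rule borel_measurable_ell2I) (simp add: coord_f mc_meas)
    define B where "B = (\<lambda>(x, t). inner (f x) (f t))"
    have lim: "(\<lambda>k. rank_kernel k mc z) \<longlonglongrightarrow> B z" for z
      using summable_LIMSEQ[OF summable_coord_mult[of "f (fst z)" "f (snd z)"]]
      by (simp add: rank_kernel_def tensor_def B_def inner_ell2_def coord_f case_prod_beta)
    have "B \<in> borel_measurable ?MM"
      by (rule borel_measurable_LIMSEQ_real[OF lim]) (rule L2_measurable[OF mc_kernel_L2])
    \<comment> \<open>Here the partial kernels converge at every point, so the identity can be taken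
      as the subsequence.\<close>
    from mc_kernel_AE_limit[OF strict_mono_id this] lim
    have B: "B \<in> L2 ?MM"
      "(\<lambda>n. l2_inner ?MM (\<lambda>z. B z - rank_kernel n mc z) (\<lambda>z. B z - rank_kernel n mc z)) \<longlonglongrightarrow> 0"
      by simp_all
    have "strain M f = l2_inner ?MM Kp Kp - (\<Sum>i. (L i)\<^sup>2)"
      unfolding strain_def strain_eq[OF B(1) B_def] by (rule dist_K_mc_kernel_limit[OF B])
    moreover have "admissible M f" using f_meas B(1) by (simp add: admissible_def B_def)
    ultimately show ?thesis unfolding is_arg_min_def using lower by force
  qed
  have kernel: "\<exists>B. is_mds_kernel M lam phi B \<and>
      (\<forall>g :: 'a \<Rightarrow> ell2. admissible M g \<longrightarrow> kernel_strain M B \<le> strain M g)"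
  proof -
    obtain B where B: "B \<in> L2 ?MM"
      "(\<lambda>n. l2_inner ?MM (\<lambda>z. B z - rank_kernel n mc z) (\<lambda>z. B z - rank_kernel n mc z)) \<longlonglongrightarrow> 0"
      by (rule mc_kernel_limit_exists)
    have "(\<lambda>(x, t). (curry B x t - (\<Sum>i<n. mds_coord lam phi i x * mds_coord lam phi i t))\<^sup>2)
        = (\<lambda>z. (B z - rank_kernel n mc z) * (B z - rank_kernel n mc z))" for n
      by (auto simp: fun_eq_iff rank_kernel_def tensor_def mds_coord_eq_mc power2_eq_square)
    then have "is_mds_kernel M lam phi (curry B)"
      using B by (simp add: is_mds_kernel_def l2_inner_def)
    moreover have "kernel_strain M (curry B) = l2_inner ?MM Kp Kp - (\<Sum>i. (L i)\<^sup>2)"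
      using strain_eq[OF B(1), of "curry B"] dist_K_mc_kernel_limit[OF B] by simp
    ultimately show ?thesis using lower by (intro exI[of _ "curry B"]) auto
  qed
  have finite_dim: "is_arg_min (strain M) (admissible M) (mds_embedding_Rm \<iota> lam phi)"
    if \<iota>: "bij_betw \<iota> UNIV {..<CARD('m)}" for \<iota> :: "'m \<Rightarrow> nat"
  proof -
    let ?m = "CARD('m)"
    let ?f = "mds_embedding_Rm \<iota> lam phi"
    \<comment> \<open>Inverting the numbering writes the inner product of \<open>real ^ 'm\<close>
      as a sum over indices below \<open>CARD('m)\<close>, so every competitor has a
      \<open>rank_kernel\<close> with \<open>p\<close> equal to the dimension.\<close>
    define \<kappa> where "\<kappa> = inv_into UNIV \<iota>"
    have inner_eq: "(\<lambda>(x, t). inner (g x) (g t)) = rank_kernel ?m (\<lambda>i x. g x $ \<kappa> i)"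
      for g :: "'a \<Rightarrow> real ^ 'm"
    proof -
      have "inner u v = (\<Sum>i<?m. u $ \<kappa> i * v $ \<kappa> i)" for u v :: "real ^ 'm"
        using sum.reindex_bij_betw[OF bij_betw_inv_into[OF \<iota>], of "\<lambda>j. u $ j * v $ j"]
        by (simp add: inner_vec_def \<kappa>_def)
      then show ?thesis by (auto simp: rank_kernel_def tensor_def fun_eq_iff)
    qed
    have f_coord: "?f x $ \<kappa> i = mc i x" if "i < ?m" for x i
      using bij_betw_inv_into_right[OF \<iota>, of i] that
      by (simp add: mds_embedding_Rm_def mds_coord_eq_mc \<kappa>_def)
    have f_kernel: "(\<lambda>(x, t). inner (?f x) (?f t)) = rank_kernel ?m mc"
      unfolding inner_eq by (auto simp: rank_kernel_def tensor_def fun_eq_iff f_coord)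
    have "?f \<in> borel_measurable M"
      using L2_measurable[OF mc_L2]
      by (subst borel_measurable_euclidean_space) (auto simp: Basis_vec_def inner_axis mds_embedding_Rm_def mds_coord_eq_mc)
    then have "admissible M ?f"
      unfolding admissible_def f_kernel using mc_kernel_L2 by blast
    moreover have "strain M ?f = l2_inner ?MM Kp Kp - (\<Sum>i<?m. (L i)\<^sup>2)"
      unfolding strain_def strain_eq[OF mc_kernel_L2 f_kernel[symmetric]]
      by (rule dist_K_mc_kernel)
    moreover have "l2_inner ?MM Kp Kp - (\<Sum>i<?m. (L i)\<^sup>2) \<le> strain M g"
      if "admissible M g" for g :: "'a \<Rightarrow> real ^ 'm"
    proof -
      have g: "g \<in> borel_measurable M" "rank_kernel ?m (\<lambda>i x. g x $ \<kappa> i) \<in> L2 ?MM"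
        using that by (auto simp: admissible_def inner_eq)
      have "(\<lambda>x. g x $ j) \<in> borel_measurable M" for j
        using iffD1[OF borel_measurable_euclidean_space g(1)]
        by (auto simp: Basis_vec_def inner_axis)
      then show ?thesis
        unfolding strain_def strain_eq[OF g(2) inner_eq[symmetric]]
        by (intro dist_K_finite_rank_ge g(2))
    qed
    ultimately show ?thesis unfolding is_arg_min_def by force
  qed
  show ?thesis using embedding kernel finite_dim by blast
qed

end
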